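(* Let $M$ be a punctured torus bundle over the circle with Anosov monodromy, let $\mathcal T=\{\mathcal T_1,\dots,\mathcal T_N\}$ be its monodromy triangulation, and let $\mathscr D_{\mathbb R}\subset(\mathbb R\setminus\{0,1\})^N$ be the deformation variety of real solutions to Thurston's equations for $(M,\mathcal T)$. Put $\mathcal V_+=\{(z_1,\dots,z_N)\in\mathscr D_{\mathbb R} : z_j>0 \text{ for all } j\}$. Then $\mathcal V_+$ is the union of two connected components of $\mathscr D_{\mathbb R}$. Each of these two components is smooth of dimension one, and at each of its points there is a positive tangent vector, i.e. a tangent vector $(v_1,\dots,v_N)\in\mathbb R^N$ to $\mathscr D_{\mathbb R}$ with $v_j>0$ for all $j$. Moreover each component is parameterized by the signed length $\log H(\epsilon)$ of the puncture curve $\epsilon$: the function $\log H(\epsilon)$ restricted to the component is a diffeomorphism onto an open subset of $\mathbb R$.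
   Context: Monodromy triangulation. Let $T=(\mathbb R^2\setminus\mathbb Z^2)/\mathbb Z^2$ be the once-punctured torus, and let $\phi\in \mathrm{SL}(2,\mathbb Z)$ be Anosov (distinct real eigenvalues). $M=T\times[0,1]/(x,0)\sim(\phi x,1)$. If $\phi$ has positive eigenvalues, then after conjugation $\phi=W:=R^{m_1}L^{n_1}\cdots R^{m_k}L^{n_k}$ with all $m_i,n_i\ge1$, $R=\begin{pmatrix}1&1\\0&1\end{pmatrix}$, $L=\begin{pmatrix}1&0\\1&1\end{pmatrix}$; if $\phi$ has negative eigenvalues the same is done with $-\phi$ in place of $\phi$, leading to the same equations. Let $W=w_1w_2\cdots w_N$ ($w_i\in\{R,L\}$), and $W_k=w_1\cdots w_k$. Let $\Delta_0$ be the ideal triangulation of $T$ with edges in directions $(1,0),(0,1),(-1,1)$ and $\Delta_k=W_k\Delta_0$. Consecutive $\Delta_{k-1},\Delta_k$ differ by a diagonal exchange, realized by an ideal tetrahedron $\mathcal T_k$ with bottom faces $\Delta_{k-1}$ and top faces $\Delta_k$. Stacking $\mathcal T_1,\dots,\mathcal T_N$ and gluing the top $\Delta_N=\phi\Delta_0$ to the bottom $\Delta_0$ by $\phi$ gives $M$ with its monodromy triangulation $\mathcal T$. Shape parameters and Thurston's equations. The shape parameter $z_j$ is assigned to the two opposite edges of $\mathcal T_j$ which are exchanged by the diagonal exchange; the other two pairs of opposite edges carry $x_j=\frac{z_j-1}{z_j}$ and $y_j=\frac1{1-z_j}$. Indices are read cyclically modulo $N$. There is one edge holonomy expression for each of the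 $N$ edges of $\mathcal T$: (i) for every maximal string of consecutive letters $R$ in $W$ in positions $j,\dots,k$: $g_j=z_{j-1}x_j^2x_{j+1}^2\cdots x_{k+1}^2z_{k+2}$, and $g_q=z_{q-1}y_q^2z_{q+1}$ for $q=j+1,\dots,k$; (ii) for every maximal string of consecutive letters $L$ in positions $j,\dots,k$: $g_j=z_{j-1}y_j^2y_{j+1}^2\cdots y_{k+1}^2z_{k+2}$, and $g_q=z_{q-1}x_q^2z_{q+1}$ for $q=j+1,\dots,k$. $\mathscr D_{\mathbb R}$ is the set of $(z_j)\in(\mathbb R\setminus\{0,1\})^N$ with $g_1=\dots=g_N=1$ and such that for each $j$ exactly two of the shape parameters appearing as factors in $g_j$ (counted with multiplicity, a square counting twice) are negative (this is the condition that the total dihedral angle around each edge is $2\pi$). Puncture curve. $\epsilon$ is the curve encircling the puncture in a fiber $T\subset M$. Its exponential length is $H(\epsilon)=(z_Nx_1z_2^{-1}y_1^{-1})^2>0$, and its signed length is $\log H(\epsilon)$. *)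

theory Defs
  imports "HOL-Analysis.Analysis"
begin

section \<open>Monodromies and their words\<close>

datatype letter = R | L

definition letter_matrix :: "letter \<Rightarrow> int^2^2" where
  "letter_matrix a = (case a of
      R \<Rightarrow> vector [vector [1, 1], vector [0, 1]]
    | L \<Rightarrow> vector [vector [1, 0], vector [1, 1]])"

definition word_matrix :: "letter list \<Rightarrow> int^2^2" where
  "word_matrix w = foldr (\<lambda>a M. letter_matrix a ** M) w (mat 1)"

definition real_matrix :: "int^2^2 \<Rightarrow> real^2^2" where
  "real_matrix A = (\<chi> i j. of_int (A $ i $ j))"

definition real_eigenvalue :: "int^2^2 \<Rightarrow> real \<Rightarrow> bool" where
  "real_eigenvalue A c \<longleftrightarrow> (\<exists>v. v \<noteq> 0 \<and> real_matrix A *v v = c *\<^sub>R v)"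

definition anosov :: "int^2^2 \<Rightarrow> bool" where
  "anosov A \<longleftrightarrow> det A = 1 \<and>
     (\<exists>c d. c \<noteq> d \<and> real_eigenvalue A c \<and> real_eigenvalue A d)"

definition block_word :: "(nat \<times> nat) list \<Rightarrow> letter list" where
  "block_word bs = concat (map (\<lambda>(m, n). replicate m R @ replicate n L) bs)"

definition SL2Z_conjugate :: "int^2^2 \<Rightarrow> int^2^2 \<Rightarrow> bool" where
  "SL2Z_conjugate A B \<longleftrightarrow> (\<exists>P. det P = 1 \<and> P ** A = B ** P)"

text \<open>
  The word read off from a monodromy \<open>\<phi>\<close>: a word of the form
  \<open>R^m1 L^n1 ... R^mk L^nk\<close> (\<open>k \<ge> 1\<close>, all exponents positive) whose matrix is conjugate to
  \<open>\<phi>\<close> if the eigenvalues of \<open>\<phi>\<close> are positive, and to \<open>- \<phi>\<close> if they are negative.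
\<close>

definition monodromy_word :: "int^2^2 \<Rightarrow> letter list \<Rightarrow> bool" where
  "monodromy_word \<phi> w \<longleftrightarrow>
     (\<exists>bs. bs \<noteq> [] \<and> (\<forall>(m, n) \<in> set bs. m \<ge> 1 \<and> n \<ge> 1) \<and> w = block_word bs) \<and>
     ((\<forall>c. real_eigenvalue \<phi> c \<longrightarrow> c > 0) \<and> SL2Z_conjugate \<phi> (word_matrix w) \<or>
      (\<forall>c. real_eigenvalue \<phi> c \<longrightarrow> c < 0) \<and> SL2Z_conjugate (- \<phi>) (word_matrix w))"


section \<open>Shape parameters and Thurston's equations\<close>

text \<open>
  The tetrahedra \<open>T_1, ..., T_N\<close> are indexed by a type \<open>'n\<close> with \<open>N\<close> elements, so that the space
  of tuples \<open>(z_1, ..., z_N)\<close> is \<open>real^'n\<close>. The labelling \<open>e\<close> gives the index of \<open>T_j\<close> as \<open>e j\<close>;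
  it is periodic, which implements the convention that indices are read modulo \<open>N\<close>
  (in particular \<open>e 0 = e N\<close>).
\<close>

definition cyclic_labelling :: "nat \<Rightarrow> (nat \<Rightarrow> 'n::finite) \<Rightarrow> bool" where
  "cyclic_labelling N e \<longleftrightarrow> range e = UNIV \<and> (\<forall>i j. e i = e j \<longleftrightarrow> i mod N = j mod N)"

definition shape_z :: "(nat \<Rightarrow> 'n::finite) \<Rightarrow> real^'n \<Rightarrow> nat \<Rightarrow> real" where
  "shape_z e z j = z $ e j"

definition shape_x :: "(nat \<Rightarrow> 'n::finite) \<Rightarrow> real^'n \<Rightarrow> nat \<Rightarrow> real" where
  "shape_x e z j = (shape_z e z j - 1) / shape_z e z j"

definition shape_y :: "(nat \<Rightarrow> 'n::finite) \<Rightarrow> real^'n \<Rightarrow> nat \<Rightarrow> real" where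
  "shape_y e z j = 1 / (1 - shape_z e z j)"

text \<open>
  Positions in a word are counted from 1, so position \<open>i\<close> of \<open>w\<close> is \<open>w ! (i - 1)\<close>. For words of
  the form \<open>block_word bs\<close> as above, which start with \<open>R\<close> and end with \<open>L\<close>, no maximal string
  wraps around cyclically.
\<close>

definition maximal_string :: "letter list \<Rightarrow> letter \<Rightarrow> nat \<Rightarrow> nat \<Rightarrow> bool" where
  "maximal_string w a j k \<longleftrightarrow>
     1 \<le> j \<and> j \<le> k \<and> k \<le> length w \<and> (\<forall>i\<in>{j..k}. w ! (i - 1) = a) \<and>
     (j = 1 \<or> w ! (j - 2) \<noteq> a) \<and> (k = length w \<or> w ! k \<noteq> a)"

text \<open>
  An edge holonomy expression is kept as the list of its factors, since the angle condition counts
  negative factors with multiplicity. For a maximal string in positions \<open>j..k\<close>, the edge \<open>j\<close> has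
  the expression \<open>first_edge\<close>, and each edge \<open>q = j+1, ..., k\<close> has \<open>inner_edge\<close>.
\<close>

definition first_edge ::
  "letter \<Rightarrow> nat \<Rightarrow> nat \<Rightarrow> (nat \<Rightarrow> 'n::finite) \<Rightarrow> real^'n \<Rightarrow> real list" where
  "first_edge a j k e z =
     (let u = (case a of R \<Rightarrow> shape_x e z | L \<Rightarrow> shape_y e z)
      in [shape_z e z (j - 1)] @ concat (map (\<lambda>i. [u i, u i]) [j..<k + 2]) @ [shape_z e z (k + 2)])"

definition inner_edge ::
  "letter \<Rightarrow> nat \<Rightarrow> (nat \<Rightarrow> 'n::finite) \<Rightarrow> real^'n \<Rightarrow> real list" where
  "inner_edge a q e z =
     (let u = (case a of R \<Rightarrow> shape_y e z | L \<Rightarrow> shape_x e z)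
      in [shape_z e z (q - 1), u q, u q, shape_z e z (q + 1)])"

text \<open>Holonomy 1 and total dihedral angle \<open>2 \<pi>\<close> (exactly two negative factors).\<close>

definition edge_condition :: "real list \<Rightarrow> bool" where
  "edge_condition fs \<longleftrightarrow> prod_list fs = 1 \<and> length (filter (\<lambda>t. t < 0) fs) = 2"

definition deformation_variety :: "letter list \<Rightarrow> (nat \<Rightarrow> 'n::finite) \<Rightarrow> (real^'n) set" where
  "deformation_variety w e =
     {z. (\<forall>i. z $ i \<noteq> 0 \<and> z $ i \<noteq> 1) \<and>
         (\<forall>a j k. maximal_string w a j k \<longrightarrow>
            edge_condition (first_edge a j k e z) \<and>
            (\<forall>q\<in>{j+1..k}. edge_condition (inner_edge a q e z)))}"

definition V_plus :: "letter list \<Rightarrow> (nat \<Rightarrow> 'n::finite) \<Rightarrow> (real^'n) set" where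
  "V_plus w e = {z \<in> deformation_variety w e. \<forall>i. z $ i > 0}"

definition puncture_length :: "nat \<Rightarrow> (nat \<Rightarrow> 'n::finite) \<Rightarrow> real^'n \<Rightarrow> real" where
  "puncture_length N e z =
     (shape_z e z N * shape_x e z 1 * inverse (shape_z e z 2) * inverse (shape_y e z 1))\<^sup>2"


section \<open>Smoothness\<close>

text \<open>\<open>C^n\<close> functions; meant for open \<open>S\<close> and Euclidean domain, where testing all directional
  derivatives of order at most \<open>n\<close> gives the usual notion.\<close>

primrec C_k_on :: "nat \<Rightarrow> 'a::euclidean_space set \<Rightarrow> ('a \<Rightarrow> 'b::real_normed_vector) \<Rightarrow> bool" where
  "C_k_on 0 S f \<longleftrightarrow> continuous_on S f"
| "C_k_on (Suc n) S f \<longleftrightarrow>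
     (\<forall>x\<in>S. f differentiable (at x)) \<and> (\<forall>v. C_k_on n S (\<lambda>x. frechet_derivative f (at x) v))"

definition smooth_on :: "'a::euclidean_space set \<Rightarrow> ('a \<Rightarrow> 'b::real_normed_vector) \<Rightarrow> bool" where
  "smooth_on S f \<longleftrightarrow> (\<forall>n. C_k_on n S f)"

text \<open>Smooth maps, diffeomorphisms and manifolds for arbitrary subsets of Euclidean spaces follow
  Milnor, \<^emph>\<open>Topology from the Differentiable Viewpoint\<close>: a map on \<open>S\<close> is smooth if it extends
  locally to smooth maps on open sets of the ambient space.\<close>

definition smooth_map :: "'a::euclidean_space set \<Rightarrow> ('a \<Rightarrow> 'b::real_normed_vector) \<Rightarrow> bool" where
  "smooth_map S f \<longleftrightarrow>
     (\<forall>x\<in>S. \<exists>U F. open U \<and> x \<in> U \<and> smooth_on U F \<and> (\<forall>y\<in>S \<inter> U. F y = f y))"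

definition diffeomorphism ::
  "'a::euclidean_space set \<Rightarrow> 'b::euclidean_space set \<Rightarrow> ('a \<Rightarrow> 'b) \<Rightarrow> bool" where
  "diffeomorphism S T f \<longleftrightarrow>
     bij_betw f S T \<and> smooth_map S f \<and> smooth_map T (inv_into S f)"

definition smooth_one_manifold :: "'a::euclidean_space set \<Rightarrow> bool" where
  "smooth_one_manifold S \<longleftrightarrow>
     (\<forall>p\<in>S. \<exists>U (J :: real set) f. open U \<and> p \<in> U \<and> open J \<and> diffeomorphism (S \<inter> U) J f)"

definition tangent_vector :: "'a::euclidean_space set \<Rightarrow> 'a \<Rightarrow> 'a \<Rightarrow> bool" where
  "tangent_vector S p v \<longleftrightarrow>
     (\<exists>(\<gamma> :: real \<Rightarrow> 'a) r. r > 0 \<and> smooth_on {-r<..<r} \<gamma> \<and> \<gamma> ` {-r<..<r} \<subseteq> S \<and>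
        \<gamma> 0 = p \<and> (\<gamma> has_vector_derivative v) (at 0))"

end

theory Submission
  imports Defs
begin

text \<open>
  For a positive point of the deformation variety the sign conditions determine, up to one binary choice,
  which coordinates are smaller than 1. Inside a string of letters they leave no freedom: the coordinate
  is greater than 1 for \<open>R\<close> and smaller than 1 for \<open>L\<close>. At the starts of the strings either all coordinates
  follow this rule, or all of them violate it. Using the equations of the inner edges, the product along
  a string telescopes, and the equation of its first edge says that a certain monomial in the shape
  parameters takes the same value \<open>h\<close> at the start of this string and at the start of the next one. So
  \<open>h\<close> is a single free parameter (lemma \<open>V_plus_iff\<close>), and \<open>H(\<epsilon>) = h\<^sup>2\<close>.

  In the coordinates \<open>t = ln z\<close>, the equations for one of the two sign patterns take the form
  \<open>holonomy t = \<eta> *\<^sub>R start_vector\<close> with \<open>\<eta> = \<plusminus> ln h\<close>, where \<open>holonomy\<close> maps an open orthant to the whole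
  space. The second pattern gives the same system as the first one with the cyclic order reversed, so
  both are treated at once in the locale \<open>string_cycle\<close>. The map \<open>holonomy\<close> is the sum of an increasing
  function of each coordinate and a linear map whose quadratic form is a sum of squares
  (\<open>coupling_sum_of_squares\<close>) and positive definite. Therefore it is strictly monotone, hence injective
  with invertible derivative, and it is proper; by invariance of domain it is a bijection
  (\<open>holonomy_surj\<close>). The solutions thus form a curve parametrised by \<open>\<eta>\<close>, which runs through all of
  \<open>\<real>\<close>. In particular the set of solutions is nonempty and connected, and the signed length, being
  \<open>\<plusminus> 2 * \<eta>\<close>, maps it onto \<open>\<real>\<close>.

  The curve is smooth since it solves a differential equation with rational right-hand side
  (\<open>smooth_curve\<close>). Its velocity is positive by a minimum principle along the cycle
  (\<open>positive_solution\<close>). Finally, coordinates of points of the deformation variety avoid 0 and 1, so sign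
  patterns are constant on its components, and the two curves are components (\<open>curves_components\<close>).
\<close>

section \<open>Smooth functions from families closed under differentiation\<close>

lemma C_k_on_cong:
  assumes "open S" "\<And>x. x \<in> S \<Longrightarrow> f x = g x" "C_k_on n S f"
  shows "C_k_on n S g"
  using assms(2,3)
proof (induction n arbitrary: f g)
  case 0
  then show ?case by (metis C_k_on.simps(1) continuous_on_cong)
next
  case (Suc n)
  have fd: "f differentiable (at x)" if "x \<in> S" for x
    using Suc.prems that by simp
  have gd: "g differentiable (at x)" if "x \<in> S" for x
    using fd[OF that] Suc.prems(1) assms(1) that
    by (meson differentiable_def has_derivative_transform_within_open)
  have eq: "frechet_derivative f (at x) v = frechet_derivative g (at x) v" if "x \<in> S" for x v
    using frechet_derivative_transform_within_open[OF fd[OF that] assms(1) that Suc.prems(1)]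
    by simp
  have "C_k_on n S (\<lambda>x. frechet_derivative g (at x) v)" for v
    using Suc.IH[of "\<lambda>x. frechet_derivative f (at x) v"] eq Suc.prems(2) by simp
  with gd show ?case by simp
qed

lemma C_k_on_subset:
  assumes "S \<subseteq> T" "C_k_on n T f"
  shows "C_k_on n S f"
  using assms(2)
  by (induction n arbitrary: f) (use assms(1) continuous_on_subset in auto)

lemma smooth_on_subset: "S \<subseteq> T \<Longrightarrow> smooth_on T f \<Longrightarrow> smooth_on S f"
  by (meson C_k_on_subset smooth_on_def)

text \<open>
  Differentiability alone gives smoothness once the directional derivatives stay inside the family:
  each derivative can then be differentiated again.
\<close>

lemma smooth_on_derivative_closed_family:
  fixes \<F> :: "('a::euclidean_space \<Rightarrow> 'b::real_normed_vector) set"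
  assumes S: "open S"
    and diff: "\<And>f x. f \<in> \<F> \<Longrightarrow> x \<in> S \<Longrightarrow> f differentiable (at x)"
    and closed: "\<And>f v. f \<in> \<F> \<Longrightarrow> \<exists>g\<in>\<F>. \<forall>x\<in>S. frechet_derivative f (at x) v = g x"
    and "f \<in> \<F>"
  shows "smooth_on S f"
proof -
  have "C_k_on n S f" if "f \<in> \<F>" for n f
    using that
  proof (induction n arbitrary: f)
    case 0
    then show ?case
      using diff by (simp add: continuous_at_imp_continuous_on differentiable_imp_continuous_within)
  next
    case (Suc n)
    have "C_k_on n S (\<lambda>x. frechet_derivative f (at x) v)" for v
    proof -
      obtain g where "g \<in> \<F>" "\<forall>x\<in>S. frechet_derivative f (at x) v = g x"
        using closed[OF Suc.prems] by blast
      then show ?thesis using Suc.IH C_k_on_cong[OF S, of g] by simp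
    qed
    then show ?case using diff Suc.prems by simp
  qed
  with assms(4) show ?thesis by (simp add: smooth_on_def)
qed

text \<open>
  Needed because the solution curves take values in \<open>real^'n\<close>, whereas the elementary functions
  below are real valued.
\<close>

lemma C_k_on_vec_lambda:
  fixes f :: "'a::euclidean_space \<Rightarrow> real^'n"
  assumes S: "open S" and "\<And>i. C_k_on n S (\<lambda>x. f x $ i)"
  shows "C_k_on n S f"
  using assms(2)
proof (induction n arbitrary: f)
  case 0
  then show ?case using continuous_on_vec_lambda[of S "\<lambda>i x. f x $ i"] by simp
next
  case (Suc n)
  have der: "(f has_derivative (\<lambda>v. \<chi> i. frechet_derivative (\<lambda>x. f x $ i) (at x) v)) (at x)"
    if "x \<in> S" for x
    unfolding has_derivative_componentwise_within[of f]
  proof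
    fix b :: "real^'n" assume "b \<in> Basis"
    then obtain i where b: "b = axis i 1" by (auto simp: Basis_vec_def)
    have "((\<lambda>x. f x $ i) has_derivative frechet_derivative (\<lambda>x. f x $ i) (at x)) (at x)"
      using Suc.prems[of i] that frechet_derivative_works by auto
    then show "((\<lambda>x. f x \<bullet> b) has_derivative
        (\<lambda>v. (\<chi> i. frechet_derivative (\<lambda>x. f x $ i) (at x) v) \<bullet> b)) (at x)"
      by (simp add: b inner_axis)
  qed
  have comp: "frechet_derivative f (at x) v $ i = frechet_derivative (\<lambda>x. f x $ i) (at x) v"
    if "x \<in> S" for x v i
    using frechet_derivative_at[OF der[OF that]] by (metis vec_lambda_beta)
  show ?case
  proof (simp, intro conjI allI ballI)
    show "f differentiable (at x)" if "x \<in> S" for x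
      using der[OF that] differentiable_def by blast
    show "C_k_on n S (\<lambda>x. frechet_derivative f (at x) v)" for v
    proof (rule Suc.IH)
      fix i
      have "C_k_on n S (\<lambda>x. frechet_derivative (\<lambda>x. f x $ i) (at x) v)"
        using Suc.prems[of i] by simp
      then show "C_k_on n S (\<lambda>x. frechet_derivative f (at x) v $ i)"
        by (rule C_k_on_cong[OF S, rotated]) (simp add: comp)
    qed
  qed
qed

lemma smooth_on_vec_lambda:
  fixes f :: "'a::euclidean_space \<Rightarrow> real^'n"
  shows "open S \<Longrightarrow> (\<And>i. smooth_on S (\<lambda>x. f x $ i)) \<Longrightarrow> smooth_on S f"
  by (simp add: C_k_on_vec_lambda smooth_on_def)

text \<open>
  Two instances matter: with the coordinates of \<open>real^'n\<close> as base functions it contains the logarithm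
  of the puncture length, and with the coordinates of a solution curve as base functions it contains
  the right-hand side of the differential equation that the curve satisfies.
\<close>

inductive elementary :: "'a::euclidean_space set \<Rightarrow> ('a \<Rightarrow> real) set \<Rightarrow> ('a \<Rightarrow> real) \<Rightarrow> bool"
  for S B where
  base: "f \<in> B \<Longrightarrow> elementary S B f"
| const: "elementary S B (\<lambda>x. c)"
| add: "elementary S B f \<Longrightarrow> elementary S B g \<Longrightarrow> elementary S B (\<lambda>x. f x + g x)"
| mult: "elementary S B f \<Longrightarrow> elementary S B g \<Longrightarrow> elementary S B (\<lambda>x. f x * g x)"
| inverse: "elementary S B f \<Longrightarrow> (\<And>x. x \<in> S \<Longrightarrow> f x \<noteq> 0) \<Longrightarrow> elementary S B (\<lambda>x. inverse (f x))"
| ln: "elementary S B f \<Longrightarrow> (\<And>x. x \<in> S \<Longrightarrow> f x > 0) \<Longrightarrow> elementary S B (\<lambda>x. ln (f x))"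

lemma elementary_sum:
  "finite I \<Longrightarrow> (\<And>i. i \<in> I \<Longrightarrow> elementary S B (f i)) \<Longrightarrow> elementary S B (\<lambda>x. \<Sum>i\<in>I. f i x)"
  by (induction I rule: finite_induct) (auto intro: elementary.intros)

lemma elementary_prod:
  "finite I \<Longrightarrow> (\<And>i. i \<in> I \<Longrightarrow> elementary S B (f i)) \<Longrightarrow> elementary S B (\<lambda>x. \<Prod>i\<in>I. f i x)"
  by (induction I rule: finite_induct) (auto intro: elementary.intros)

lemma elementary_diff:
  "elementary S B f \<Longrightarrow> elementary S B g \<Longrightarrow> elementary S B (\<lambda>x. f x - g x)"
  using elementary.add[of S B f "\<lambda>x. -1 * g x"] elementary.mult[of S B "\<lambda>x. -1" g]
  by (simp add: elementary.const)

lemma elementary_divide: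
  "elementary S B f \<Longrightarrow> elementary S B g \<Longrightarrow> (\<And>x. x \<in> S \<Longrightarrow> g x \<noteq> 0)
   \<Longrightarrow> elementary S B (\<lambda>x. f x / g x)"
  by (simp add: divide_inverse elementary.inverse elementary.mult)

lemma elementary_det:
  fixes A :: "'a::euclidean_space \<Rightarrow> real^'n^'n"
  assumes "\<And>i j. elementary S B (\<lambda>x. A x $ i $ j)"
  shows "elementary S B (\<lambda>x. det (A x))"
  unfolding det_def
  by (intro elementary_sum elementary.mult elementary.const elementary_prod assms) auto

text \<open>
  Only the base functions need to be differentiated by hand; the product, quotient and chain rules
  produce elementary functions again.
\<close>

lemma elementary_has_derivative:
  assumes base: "\<And>f. f \<in> B \<Longrightarrow>
      \<exists>f'. (\<forall>x\<in>S. (f has_derivative f' x) (at x)) \<and> (\<forall>v. elementary S B (\<lambda>x. f' x v))"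
    and "elementary S B f"
  shows "\<exists>f'. (\<forall>x\<in>S. (f has_derivative f' x) (at x)) \<and> (\<forall>v. elementary S B (\<lambda>x. f' x v))"
  using assms(2)
proof (induction rule: elementary.induct)
  case (base f)
  then show ?case using assms(1) by blast
next
  case (const c)
  show ?case by (rule exI[of _ "\<lambda>x v. 0"]) (auto intro: elementary.const)
next
  case (add f g)
  then obtain f' g' where
    "\<forall>x\<in>S. (f has_derivative f' x) (at x)" "\<forall>v. elementary S B (\<lambda>x. f' x v)"
    "\<forall>x\<in>S. (g has_derivative g' x) (at x)" "\<forall>v. elementary S B (\<lambda>x. g' x v)" by blast
  then show ?case
    by (intro exI[of _ "\<lambda>x v. f' x v + g' x v"])
      (auto intro: elementary.add has_derivative_add)
next
  case (mult f g)
  then obtain f' g' where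
    "\<forall>x\<in>S. (f has_derivative f' x) (at x)" "\<forall>v. elementary S B (\<lambda>x. f' x v)"
    "\<forall>x\<in>S. (g has_derivative g' x) (at x)" "\<forall>v. elementary S B (\<lambda>x. g' x v)" by blast
  with mult.hyps show ?case
    by (intro exI[of _ "\<lambda>x v. f x * g' x v + f' x v * g x"])
      (auto intro!: elementary.add elementary.mult has_derivative_mult)
next
  case (inverse f)
  then obtain f' where f':
    "\<forall>x\<in>S. (f has_derivative f' x) (at x)" "\<forall>v. elementary S B (\<lambda>x. f' x v)" by blast
  show ?case
  proof (intro exI[of _ "\<lambda>x v. - (inverse (f x) * f' x v * inverse (f x))"] conjI ballI allI)
    show "((\<lambda>x. inverse (f x)) has_derivative
        (\<lambda>v. - (inverse (f x) * f' x v * inverse (f x)))) (at x)" if "x \<in> S" for x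
      using that f' inverse by (intro Deriv.has_derivative_inverse) auto
    have "elementary S B (\<lambda>x. 0 - inverse (f x) * f' x v * inverse (f x))" for v
      using f' inverse by (intro elementary_diff elementary.intros(2-5)) auto
    then show "elementary S B (\<lambda>x. - (inverse (f x) * f' x v * inverse (f x)))" for v by simp
  qed
next
  case (ln f)
  then obtain f' where f':
    "\<forall>x\<in>S. (f has_derivative f' x) (at x)" "\<forall>v. elementary S B (\<lambda>x. f' x v)" by blast
  show ?case
  proof (intro exI[of _ "\<lambda>x v. f' x v * inverse (f x)"] conjI ballI allI)
    show "((\<lambda>x. ln (f x)) has_derivative (\<lambda>v. f' x v * inverse (f x))) (at x)" if "x \<in> S" for x
      using has_derivative_ln[of f x "f' x" UNIV] that f' ln.hyps by simp
    have "f x \<noteq> 0" if "x \<in> S" for x using ln.hyps(2)[OF that] by simp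
    then show "elementary S B (\<lambda>x. f' x v * inverse (f x))" for v
      using f' ln.hyps by (intro elementary.intros(2-5)) auto
  qed
qed

lemma elementary_smooth_on:
  assumes S: "open S"
    and base: "\<And>f. f \<in> B \<Longrightarrow>
      \<exists>f'. (\<forall>x\<in>S. (f has_derivative f' x) (at x)) \<and> (\<forall>v. elementary S B (\<lambda>x. f' x v))"
    and "elementary S B f"
  shows "smooth_on S f"
proof (rule smooth_on_derivative_closed_family[OF S, of "Collect (elementary S B)"])
  have der: "\<exists>f'. (\<forall>x\<in>S. (f has_derivative f' x) (at x)) \<and> (\<forall>v. elementary S B (\<lambda>x. f' x v))"
    if "elementary S B f" for f
    using base that by (rule elementary_has_derivative)
  show "f differentiable (at x)" if "f \<in> Collect (elementary S B)" "x \<in> S" for f x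
    using der[of f] that by (metis differentiableI mem_Collect_eq)
  show "\<exists>g\<in>Collect (elementary S B). \<forall>x\<in>S. frechet_derivative f (at x) v = g x"
    if "f \<in> Collect (elementary S B)" for f v
    using der[of f] that frechet_derivative_at by (metis mem_Collect_eq)
qed (use assms in auto)

text \<open>
  The solution curve of an autonomous differential equation with elementary right-hand side is smooth,
  because the family generated by its coordinates is closed under differentiation.
\<close>

lemma smooth_solution_curve:
  fixes z :: "real \<Rightarrow> real^'n"
  assumes "\<And>s. (z has_vector_derivative z' s) (at s)"
    and "\<And>i. elementary UNIV (range (\<lambda>i s. z s $ i)) (\<lambda>s. z' s $ i)"
  shows "smooth_on UNIV z"
proof (rule smooth_on_vec_lambda[OF open_UNIV])
  fix i
  show "smooth_on UNIV (\<lambda>s. z s $ i)"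
  proof (rule elementary_smooth_on[of _ "range (\<lambda>i s. z s $ i)"])
    fix f assume "f \<in> range (\<lambda>i s. z s $ i)"
    then obtain i where f: "f = (\<lambda>s. z s $ i)" by blast
    have "(f has_derivative (\<lambda>h. h * z' s $ i)) (at s)" for s
      unfolding f using bounded_linear.has_derivative[OF bounded_linear_vec_nth]
        assms(1)[of s, unfolded has_vector_derivative_def] by fastforce
    then show "\<exists>f'. (\<forall>x\<in>UNIV. (f has_derivative f' x) (at x)) \<and>
        (\<forall>v. elementary UNIV (range (\<lambda>i s. z s $ i)) (\<lambda>x. f' x v))"
      by (intro exI[of _ "\<lambda>s h. h * z' s $ i"]) (auto intro!: elementary.intros(3,4,2) assms(2))
  qed (auto intro: elementary.base)
qed

lemma elementary_coordinates_smooth_on: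
  fixes f :: "real^'n \<Rightarrow> real"
  assumes "open S" "elementary S (range (\<lambda>i z. z $ i)) f"
  shows "smooth_on S f"
proof (rule elementary_smooth_on[OF assms(1) _ assms(2)])
  fix f :: "real^'n \<Rightarrow> real" assume "f \<in> range (\<lambda>i z. z $ i)"
  then obtain i where f: "f = (\<lambda>z. z $ i)" by blast
  have "(f has_derivative (\<lambda>v. v $ i)) (at z)" for z
    unfolding f by (rule bounded_linear_imp_has_derivative[OF bounded_linear_vec_nth])
  then show "\<exists>f'. (\<forall>x\<in>S. (f has_derivative f' x) (at x)) \<and>
        (\<forall>v. elementary S (range (\<lambda>i z. z $ i)) (\<lambda>x. f' x v))"
    by (intro exI[of _ "\<lambda>x v. v $ i"]) (auto intro: elementary.const)
qed

section \<open>The normalised system in logarithmic coordinates\<close>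

text \<open>
  In terms of \<open>t = ln z\<close>, a letter stands for one of the two ways in which a positive shape parameter
  can avoid 1: \<open>R\<close> for \<open>z > 1\<close>, where \<open>x = (z - 1) / z\<close> is positive, and \<open>L\<close> for \<open>z < 1\<close>, where
  \<open>y = 1 / (1 - z)\<close> is positive. In both cases \<open>log_shape\<close> is the logarithm of the square of that
  positive parameter. It is an increasing function of \<open>t\<close> that becomes infinite at 0.
\<close>

definition side :: "letter \<Rightarrow> real \<Rightarrow> bool" where
  "side a t \<longleftrightarrow> (case a of R \<Rightarrow> t > 0 | L \<Rightarrow> t < 0)"

definition log_shape :: "letter \<Rightarrow> real \<Rightarrow> real" where
  "log_shape a t = (case a of R \<Rightarrow> 2 * ln (1 - exp (- t)) | L \<Rightarrow> - 2 * ln (1 - exp t))"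

definition log_shape_deriv :: "letter \<Rightarrow> real \<Rightarrow> real" where
  "log_shape_deriv a t =
     (case a of R \<Rightarrow> 2 * exp (- t) / (1 - exp (- t)) | L \<Rightarrow> 2 * exp t / (1 - exp t))"

lemma log_shape_deriv:
  "side a t \<Longrightarrow> (log_shape a has_real_derivative log_shape_deriv a t) (at t)"
  unfolding log_shape_def[abs_def] log_shape_deriv_def side_def
  by (cases a) (auto intro!: derivative_eq_intros simp: field_simps)

lemma log_shape_deriv_pos: "side a t \<Longrightarrow> log_shape_deriv a t > 0"
  by (cases a) (auto simp: log_shape_deriv_def side_def)

lemma log_shape_mono:
  assumes "side a s" "side a t"
  shows "(log_shape a s - log_shape a t) * (s - t) \<ge> 0"
proof -
  have "log_shape a s \<le> log_shape a t" if "side a s" "side a t" "s \<le> t" for s t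
    using that by (cases a) (auto simp: log_shape_def side_def)
  then have "s \<le> t \<and> log_shape a s \<le> log_shape a t \<or> t \<le> s \<and> log_shape a t \<le> log_shape a s"
    using assms by (meson linear)
  then show ?thesis
    by (auto intro: mult_nonneg_nonneg mult_nonpos_nonpos)
qed

text \<open>
  Since \<open>log_shape\<close> is negative on the positive axis and positive on the negative axis, this product is
  never positive; being bounded below, it cannot spoil the coercivity of the linear part.
\<close>

lemma log_shape_times_bounded_below: "side a t \<Longrightarrow> t * log_shape a t \<ge> -2"
proof -
  have *: "u * ln (1 - exp (- u)) \<ge> -1" if "u > 0" for u :: real
  proof -
    have "ln (inverse (1 - exp (- u))) \<le> inverse (1 - exp (- u)) - 1"
      using that by (intro ln_le_minus_one) simp
    then have "ln (1 - exp (- u)) \<ge> 1 - inverse (1 - exp (- u))"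
      using that by (simp add: ln_inverse)
    also have "1 - inverse (1 - exp (- u)) = - (1 / (exp u - 1))"
      using that by (simp add: exp_minus field_simps)
    finally have "u * ln (1 - exp (- u)) \<ge> u * (- (1 / (exp u - 1)))"
      using that by (intro mult_left_mono) auto
    moreover have "u * (1 / (exp u - 1)) \<le> 1"
      using that exp_ge_add_one_self[of u] by (simp add: field_simps)
    ultimately show ?thesis by simp
  qed
  assume "side a t"
  then show ?thesis
    using *[of t] *[of "-t"] by (cases a) (auto simp: log_shape_def side_def)
qed

text \<open>A lower bound on the logarithm keeps the argument away from the boundary point 0.\<close>

lemma side_limit:
  assumes "\<And>n. side a (t n)" "t \<longlonglongrightarrow> l" "\<And>n. \<bar>log_shape a (t n)\<bar> \<le> B"
  shows "side a l"
proof (cases a)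
  case R
  have "1 - exp (- t n) \<ge> exp (- B / 2)" for n
  proof -
    have "ln (1 - exp (- t n)) \<ge> - B / 2"
      using assms(3)[of n] R by (simp add: log_shape_def)
    then show ?thesis
      using assms(1)[of n] R by (simp add: ln_ge_iff side_def)
  qed
  moreover have "(\<lambda>n. 1 - exp (- t n)) \<longlonglongrightarrow> 1 - exp (- l)"
    using assms(2) by (intro tendsto_intros)
  ultimately have "1 - exp (- l) \<ge> exp (- B / 2)"
    by (meson LIMSEQ_le_const)
  then have "exp (- l) < 1"
    by (smt (verit) exp_gt_zero)
  then show ?thesis using R by (simp add: side_def)
next
  case L
  have "1 - exp (t n) \<ge> exp (- B / 2)" for n
  proof -
    have "ln (1 - exp (t n)) \<ge> - B / 2"
      using assms(3)[of n] L by (simp add: log_shape_def)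
    then show ?thesis
      using assms(1)[of n] L by (simp add: ln_ge_iff side_def)
  qed
  moreover have "(\<lambda>n. 1 - exp (t n)) \<longlonglongrightarrow> 1 - exp l"
    using assms(2) by (intro tendsto_intros)
  ultimately have "1 - exp l \<ge> exp (- B / 2)"
    by (meson LIMSEQ_le_const)
  then have "exp l < 1"
    by (smt (verit) exp_gt_zero)
  then show ?thesis using L by (simp add: side_def)
qed

section \<open>Bijectivity of the logarithmic holonomy map\<close>

text \<open>
  The cyclic order of the tetrahedra is given by the mutually inverse maps \<open>nx\<close> and \<open>pv\<close>, and \<open>S\<close> is the
  set of indices at which a new string of letters begins. The letters \<open>c\<close> select the chamber in which a
  solution is sought. As the assumptions are symmetric in \<open>nx\<close> and \<open>pv\<close>, the locale
  can be applied to both orientations of the cycle.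
\<close>

locale string_cycle =
  fixes nx pv :: "'n::finite \<Rightarrow> 'n" and S :: "'n set" and c :: "'n \<Rightarrow> letter"
  assumes nx_pv [simp]: "nx (pv i) = i"
    and pv_nx [simp]: "pv (nx i) = i"
    and reach_nx: "\<exists>m. (nx ^^ m) i \<in> S"
    and reach_pv: "\<exists>m. (pv ^^ m) i \<in> S"
begin

text \<open>
  Taking logarithms turns the edge equations into \<open>holonomy t = \<eta> *\<^sub>R start_vector\<close>: a diagonal
  increasing nonlinearity plus the linear map \<open>coupling\<close>. The right-hand side vanishes at inner
  indices and has the common value \<open>\<eta>\<close>, the free parameter of the solution curve, at all starts.
\<close>

definition coupling :: "real^'n \<Rightarrow> real^'n" where
  "coupling t = (\<chi> i. (if i \<in> S then t $ i + t $ pv i else 2 * t $ i - t $ pv i) - t $ nx i)"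

definition chamber :: "(real^'n) set" where
  "chamber = {t. \<forall>i. side (c i) (t $ i)}"

definition holonomy :: "real^'n \<Rightarrow> real^'n" where
  "holonomy t = (\<chi> i. log_shape (c i) (t $ i)) + coupling t"

definition holonomy_deriv :: "real^'n \<Rightarrow> real^'n \<Rightarrow> real^'n" where
  "holonomy_deriv t v = (\<chi> i. log_shape_deriv (c i) (t $ i) * v $ i) + coupling v"

definition start_vector :: "real^'n" where
  "start_vector = (\<chi> i. if i \<in> S then 1 else 0)"

lemma sum_nx: "(\<Sum>i\<in>UNIV. f (nx i)) = (\<Sum>i\<in>UNIV. f i)"
  by (rule sum.reindex_bij_witness[of _ pv nx]) auto

lemma linear_coupling: "linear coupling"
  by (rule linearI) (auto simp: coupling_def vec_eq_iff algebra_simps)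

text \<open>
  At a start the two neighbours enter \<open>coupling\<close> with opposite signs, at an inner index with the same
  sign. Hence in the quadratic form the contributions of \<open>t $ i * t $ nx i\<close> from the rows \<open>i\<close> and \<open>nx i\<close>
  cancel if \<open>nx i\<close> is a start and add up to \<open>- 2 * t $ i * t $ nx i\<close> otherwise, which completes the
  square.
\<close>

lemma coupling_sum_of_squares:
  "coupling t \<bullet> t = (\<Sum>i\<in>UNIV. (t $ i - (if nx i \<in> S then 0 else t $ nx i))\<^sup>2)"
proof -
  \<comment> \<open>The part of the square with index \<open>pv i\<close> that involves \<open>t $ i\<close>; summing it over \<open>nx i\<close> instead of \<open>i\<close> changes nothing.\<close>
  define h where "h i = (if i \<in> S then 0 else (t $ i)\<^sup>2 - 2 * t $ i * t $ pv i)" for i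
  have "(\<Sum>i\<in>UNIV. (t $ i - (if nx i \<in> S then 0 else t $ nx i))\<^sup>2)
      = (\<Sum>i\<in>UNIV. (t $ i)\<^sup>2 + h (nx i))"
    by (rule sum.cong) (auto simp: h_def power2_eq_square algebra_simps)
  also have "\<dots> = (\<Sum>i\<in>UNIV. (t $ i)\<^sup>2 + h i)"
    by (simp add: sum.distrib sum_nx)
  also have "\<dots> = (\<Sum>i\<in>UNIV. (coupling t $ i * t $ i) + t $ i * t $ nx i - t $ i * t $ pv i)"
    by (rule sum.cong) (auto simp: coupling_def h_def power2_eq_square algebra_simps)
  also have "\<dots> = (\<Sum>i\<in>UNIV. coupling t $ i * t $ i)"
    using sum_nx[of "\<lambda>i. t $ pv i * t $ i"]
    by (simp add: sum.distrib sum_subtractf mult.commute)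
  finally show ?thesis by (simp add: inner_vec_def)
qed

text \<open>
  If all squares vanish, then the coordinate just before a start is 0, and going backwards so are all
  the others. A form on a finite-dimensional space that vanishes only at 0 has a positive lower bound
  on the unit sphere.
\<close>

lemma coupling_coercive:
  obtains m where "m > 0" "\<And>t. coupling t \<bullet> t \<ge> m * (norm t)\<^sup>2"
proof -
  define P :: "real^'n \<Rightarrow> real^'n"
    where "P t = (\<chi> i. t $ i - (if nx i \<in> S then 0 else t $ nx i))" for t
  have lin: "linear P"
    by (rule linearI) (auto simp: P_def vec_eq_iff algebra_simps)
  have "t = 0" if "P t = 0" for t
  proof -
    have eq: "t $ i = (if nx i \<in> S then 0 else t $ nx i)" for i
      using arg_cong[OF that, of "\<lambda>x. x $ i"] by (simp add: P_def)
    have "(nx ^^ m) (nx i) \<in> S \<Longrightarrow> t $ i = 0" for m i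
    proof (induction m arbitrary: i)
      case 0
      then show ?case using eq[of i] by simp
    next
      case (Suc m)
      then have "t $ nx i = 0" using Suc.IH[of "nx i"] by (simp add: funpow_swap1)
      then show ?case using eq[of i] by simp
    qed
    then show ?thesis using reach_nx by (metis vec_eq_iff zero_index)
  qed
  then have "inj P" using lin linear_injective_0 by blast
  then obtain b where b: "b > 0" "\<And>t. b * norm t \<le> norm (P t)"
    using linear_inj_bounded_below_pos[OF lin] by blast
  have "coupling t \<bullet> t \<ge> b\<^sup>2 * (norm t)\<^sup>2" for t
  proof -
    have "coupling t \<bullet> t = P t \<bullet> P t"
      unfolding coupling_sum_of_squares by (simp add: P_def inner_vec_def power2_eq_square)
    then have "coupling t \<bullet> t = (norm (P t))\<^sup>2"
      by (simp add: power2_norm_eq_inner)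
    moreover have "(b * norm t)\<^sup>2 \<le> (norm (P t))\<^sup>2"
      using b by (intro power_mono) auto
    ultimately show ?thesis by (simp add: power_mult_distrib)
  qed
  with b(1) show ?thesis by (intro that[of "b\<^sup>2"]) auto
qed

lemma open_chamber: "open chamber"
proof -
  have "open {t :: real^'n. side (c i) (t $ i)}" for i
    by (cases "c i") (auto simp: side_def intro!: open_Collect_less continuous_intros)
  moreover have "chamber = (\<Inter>i. {t. side (c i) (t $ i)})" by (auto simp: chamber_def)
  ultimately show ?thesis by (simp add: open_INT)
qed

lemma chamber_nonempty: "chamber \<noteq> {}"
proof -
  have "(\<chi> i. case c i of R \<Rightarrow> 1 | L \<Rightarrow> -1) \<in> chamber"
    by (auto simp: chamber_def side_def split: letter.split)
  then show ?thesis by blast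
qed

lemma holonomy_has_derivative:
  assumes "t \<in> chamber"
  shows "(holonomy has_derivative holonomy_deriv t) (at t)"
proof -
  have "((\<lambda>t. log_shape (c i) (t $ i)) has_derivative
      (\<lambda>v. log_shape_deriv (c i) (t $ i) * v $ i)) (at t)" for i
  proof -
    have "(log_shape (c i) has_derivative (\<lambda>v. log_shape_deriv (c i) (t $ i) * v)) (at (t $ i))"
      using log_shape_deriv assms by (simp add: chamber_def has_field_derivative_def)
    from has_derivative_compose[OF bounded_linear_imp_has_derivative[OF bounded_linear_vec_nth] this]
    show ?thesis .
  qed
  then have "((\<lambda>t. \<chi> i. log_shape (c i) (t $ i)) has_derivative
      (\<lambda>v. \<chi> i. log_shape_deriv (c i) (t $ i) * v $ i)) (at t)"
    unfolding has_derivative_componentwise_within[of "\<lambda>t. \<chi> i. log_shape (c i) (t $ i)"]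
    by (auto simp: Basis_vec_def inner_axis)
  moreover have "(coupling has_derivative coupling) (at t)"
    using linear_coupling linear_imp_has_derivative by blast
  ultimately show ?thesis
    unfolding holonomy_def[abs_def] holonomy_deriv_def[abs_def] by (rule has_derivative_add)
qed

lemma linear_holonomy_deriv: "linear (holonomy_deriv t)"
  using linear_coupling
  by (intro linearI) (auto simp: holonomy_deriv_def linear_add linear_scale vec_eq_iff algebra_simps)

text \<open>
  Pairing with \<open>v\<close>: the diagonal part contributes a nonnegative amount since \<open>log_shape\<close> increases, and
  \<open>coupling\<close> is positive definite.
\<close>

lemma holonomy_deriv_inj:
  assumes "t \<in> chamber"
  shows "inj (holonomy_deriv t)"
  unfolding linear_injective_0[OF linear_holonomy_deriv]
proof (intro allI impI)
  fix v assume 0: "holonomy_deriv t v = 0"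
  obtain m where m: "m > 0" "\<And>t. coupling t \<bullet> t \<ge> m * (norm t)\<^sup>2"
    using coupling_coercive by blast
  have "0 = (\<Sum>i\<in>UNIV. log_shape_deriv (c i) (t $ i) * v $ i * v $ i) + coupling v \<bullet> v"
    using arg_cong[OF 0, of "\<lambda>x. x \<bullet> v"]
    by (simp add: holonomy_deriv_def inner_add_left inner_vec_def[of "vec_lambda _"])
  moreover have "log_shape_deriv (c i) (t $ i) * v $ i * v $ i \<ge> 0" for i
    using log_shape_deriv_pos[of "c i" "t $ i"] assms
    by (auto simp: chamber_def mult.assoc intro!: mult_nonneg_nonneg less_imp_le)
  then have "(\<Sum>i\<in>UNIV. log_shape_deriv (c i) (t $ i) * v $ i * v $ i) \<ge> 0"
    by (simp add: sum_nonneg)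
  ultimately have "m * (norm v)\<^sup>2 \<le> 0" using m(2)[of v] by linarith
  then show "v = 0" using m(1) by (simp add: mult_le_0_iff)
qed

text \<open>
  The same pairing for two points instead of a tangent vector: \<open>holonomy\<close> is a strictly monotone
  operator.
\<close>

lemma holonomy_inj: "inj_on holonomy chamber"
proof (rule inj_onI)
  fix s t assume st: "s \<in> chamber" "t \<in> chamber" and eq: "holonomy s = holonomy t"
  obtain m where m: "m > 0" "\<And>t. coupling t \<bullet> t \<ge> m * (norm t)\<^sup>2"
    using coupling_coercive by blast
  have "0 = (holonomy s - holonomy t) \<bullet> (s - t)" using eq by simp
  also have "\<dots> = ((\<chi> i. log_shape (c i) (s $ i)) - (\<chi> i. log_shape (c i) (t $ i))) \<bullet> (s - t)
      + (coupling s - coupling t) \<bullet> (s - t)"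
    by (simp add: holonomy_def algebra_simps inner_add_left inner_diff_left)
  also have "\<dots> = (\<Sum>i\<in>UNIV. (log_shape (c i) (s $ i) - log_shape (c i) (t $ i)) * (s $ i - t $ i))
      + coupling (s - t) \<bullet> (s - t)"
    using linear_coupling by (simp add: inner_vec_def linear_diff)
  finally have "(\<Sum>i\<in>UNIV. (log_shape (c i) (s $ i) - log_shape (c i) (t $ i)) * (s $ i - t $ i))
      + coupling (s - t) \<bullet> (s - t) = 0" by simp
  moreover have "(\<Sum>i\<in>UNIV. (log_shape (c i) (s $ i) - log_shape (c i) (t $ i)) * (s $ i - t $ i)) \<ge> 0"
    using st by (intro sum_nonneg log_shape_mono) (auto simp: chamber_def)
  ultimately have "m * (norm (s - t))\<^sup>2 \<le> 0" using m(2)[of "s - t"] by linarith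
  then show "s = t" using m(1) by (simp add: mult_le_0_iff)
qed

text \<open>
  In the pairing of \<open>holonomy t\<close> with \<open>t\<close> the quadratic growth of the linear part dominates, the
  nonlinear part being bounded below. So points whose image is bounded are bounded.
\<close>

lemma chamber_bound:
  obtains M where "\<And>t. t \<in> chamber \<Longrightarrow> norm t \<le> M * (norm (holonomy t) + 1)"
proof -
  obtain m where m: "m > 0" "\<And>t. coupling t \<bullet> t \<ge> m * (norm t)\<^sup>2"
    using coupling_coercive by blast
  \<comment> \<open>The total loss when each of the nonlinear terms is at least -2.\<close>
  define N where "N = 2 * real CARD('n)"
  have "norm t \<le> ((1 + N) / m + 1) * (norm (holonomy t) + 1)" if "t \<in> chamber" for t
  proof -
    have "(\<chi> i. log_shape (c i) (t $ i)) \<bullet> t = (\<Sum>i\<in>UNIV. t $ i * log_shape (c i) (t $ i))"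
      by (simp add: inner_vec_def mult.commute)
    also have "\<dots> \<ge> (\<Sum>i\<in>(UNIV::'n set). -2)"
      using that by (intro sum_mono log_shape_times_bounded_below) (auto simp: chamber_def)
    finally have "holonomy t \<bullet> t \<ge> m * (norm t)\<^sup>2 - N"
      using m(2)[of t] by (simp add: holonomy_def inner_add_left N_def)
    moreover have "holonomy t \<bullet> t \<le> norm (holonomy t) * norm t" by (rule norm_cauchy_schwarz)
    ultimately have *: "m * (norm t)\<^sup>2 \<le> norm (holonomy t) * norm t + N" by linarith
    show ?thesis
    proof (cases "norm t \<le> 1")
      case True
      have "N \<ge> 0" by (simp add: N_def)
      then have "1 \<le> (1 + N) / m + 1" using m(1) by simp
      then have "1 * 1 \<le> ((1 + N) / m + 1) * (norm (holonomy t) + 1)"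
        by (intro mult_mono) auto
      then show ?thesis using True by linarith
    next
      case False
      have N: "N \<ge> 0" by (simp add: N_def)
      then have "N \<le> N * norm t" using False by (simp add: mult_le_cancel_left1)
      with * have "(m * norm t) * norm t \<le> (norm (holonomy t) + N) * norm t"
        by (simp add: power2_eq_square algebra_simps)
      then have "m * norm t \<le> norm (holonomy t) + N"
        by (rule mult_right_le_imp_le) (use False in linarith)
      also have "\<dots> \<le> (1 + N) * (norm (holonomy t) + 1)"
        using N by (simp add: algebra_simps)
      finally have "norm t \<le> (1 + N) / m * (norm (holonomy t) + 1)"
        using m(1) by (simp add: field_simps)
      also have "\<dots> \<le> ((1 + N) / m + 1) * (norm (holonomy t) + 1)"
        by (intro mult_right_mono) auto
      finally show ?thesis .
    qed
  qed
  then show ?thesis using that by blast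
qed

lemma continuous_holonomy: "continuous_on chamber holonomy"
  using holonomy_has_derivative has_derivative_continuous continuous_at_imp_continuous_on by blast

text \<open>
  Properness: a sequence with convergent images stays bounded, and it cannot approach a wall of the
  chamber, where some \<open>log_shape\<close> becomes infinite while \<open>holonomy\<close> and \<open>coupling\<close> stay bounded.
\<close>

lemma closed_holonomy_image: "closed (holonomy ` chamber)"
  unfolding closed_sequential_limits
proof (intro allI impI, elim conjE)
  fix y l assume y: "\<forall>n. y n \<in> holonomy ` chamber" and l: "y \<longlonglongrightarrow> l"
  then have "\<exists>t. \<forall>n. t n \<in> chamber \<and> holonomy (t n) = y n"
  proof (intro choice allI)
    fix n
    from y have "y n \<in> holonomy ` chamber" ..
    then show "\<exists>t. t \<in> chamber \<and> holonomy t = y n" by (elim imageE) auto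
  qed
  then obtain t where t: "\<And>n. t n \<in> chamber" "\<And>n. holonomy (t n) = y n"
    by auto
  obtain B where B: "\<And>n. norm (y n) \<le> B"
    using l by (metis BseqE Bseq_eq_bounded convergent_imp_Bseq convergentI)
  obtain M where M: "\<And>t. t \<in> chamber \<Longrightarrow> norm t \<le> M * (norm (holonomy t) + 1)"
    using chamber_bound by blast
  have tb: "norm (t n) \<le> \<bar>M\<bar> * (B + 1)" for n
  proof -
    have "norm (t n) \<le> M * (norm (y n) + 1)" using M[OF t(1)[of n]] t(2)[of n] by simp
    also have "\<dots> \<le> \<bar>M\<bar> * (B + 1)" using B[of n] by (intro mult_mono) auto
    finally show ?thesis .
  qed
  then have "bounded (range t)" by (auto simp: bounded_iff)
  then obtain \<tau> r where r: "strict_mono r" and \<tau>: "(t \<circ> r) \<longlonglongrightarrow> \<tau>"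
    using bounded_imp_convergent_subsequence by blast
  obtain C where C: "\<And>t. norm (coupling t) \<le> C * norm t"
    using linear_coupling linear_bounded by blast
  have "\<tau> \<in> chamber"
    unfolding chamber_def
  proof (intro CollectI allI)
    fix i
    show "side (c i) (\<tau> $ i)"
    proof (rule side_limit)
      fix n
      show "side (c i) ((t \<circ> r) n $ i)" using t(1) by (simp add: chamber_def)
      show "(\<lambda>n. (t \<circ> r) n $ i) \<longlonglongrightarrow> \<tau> $ i" using \<tau> by (rule tendsto_vec_nth)
      have "log_shape (c i) ((t \<circ> r) n $ i) = y (r n) $ i - coupling (t (r n)) $ i"
        using t(2)[of "r n"] by (auto simp: holonomy_def vec_eq_iff algebra_simps)
      moreover have "\<bar>y (r n) $ i\<bar> \<le> B"
        using B[of "r n"] component_le_norm_cart[of "y (r n)" i] by linarith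
      moreover have "\<bar>coupling (t (r n)) $ i\<bar> \<le> \<bar>C\<bar> * (\<bar>M\<bar> * (B + 1))"
      proof -
        have "\<bar>coupling (t (r n)) $ i\<bar> \<le> C * norm (t (r n))"
          using C[of "t (r n)"] component_le_norm_cart[of "coupling (t (r n))" i] by linarith
        also have "\<dots> \<le> \<bar>C\<bar> * (\<bar>M\<bar> * (B + 1))" using tb[of "r n"] by (intro mult_mono) auto
        finally show ?thesis .
      qed
      ultimately show "\<bar>log_shape (c i) ((t \<circ> r) n $ i)\<bar> \<le> B + \<bar>C\<bar> * (\<bar>M\<bar> * (B + 1))" by linarith
    qed
  qed
  then have "isCont holonomy \<tau>" using holonomy_has_derivative has_derivative_continuous by blast
  then have "(\<lambda>n. holonomy ((t \<circ> r) n)) \<longlonglongrightarrow> holonomy \<tau>" using \<tau> isCont_tendsto_compose by blast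
  moreover have "(\<lambda>n. holonomy ((t \<circ> r) n)) = y \<circ> r" using t(2) by auto
  ultimately have "l = holonomy \<tau>"
    using LIMSEQ_subseq_LIMSEQ[OF l r] LIMSEQ_unique by metis
  with \<open>\<tau> \<in> chamber\<close> show "l \<in> holonomy ` chamber" by blast
qed

text \<open>
  The image is open by invariance of domain and closed by properness, and the whole space is connected.
\<close>

lemma holonomy_surj: "holonomy ` chamber = UNIV"
proof -
  have "open (holonomy ` chamber)"
    by (rule invariance_of_domain[OF continuous_holonomy open_chamber holonomy_inj])
  with closed_holonomy_image have "holonomy ` chamber = {} \<or> holonomy ` chamber = UNIV"
    using clopen by metis
  then show ?thesis using chamber_nonempty by simp
qed

definition solution :: "real^'n \<Rightarrow> real^'n" where
  "solution = inv_into chamber holonomy"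

lemma solution_in_chamber: "solution y \<in> chamber"
  unfolding solution_def by (rule inv_into_into) (simp add: holonomy_surj)

lemma holonomy_solution [simp]: "holonomy (solution y) = y"
  unfolding solution_def by (rule f_inv_into_f) (simp add: holonomy_surj)

lemma solution_holonomy: "t \<in> chamber \<Longrightarrow> solution (holonomy t) = t"
  unfolding solution_def by (rule inv_into_f_f[OF holonomy_inj])

lemma solution_has_derivative:
  obtains D where "(solution has_derivative D) (at y)"
    "\<And>v. holonomy_deriv (solution y) (D v) = v"
proof -
  let ?A = "holonomy_deriv (solution y)"
  have "surj ?A"
    using linear_injective_imp_surjective linear_holonomy_deriv holonomy_deriv_inj
      solution_in_chamber by blast
  then have A: "?A \<circ> inv ?A = id" by (simp add: surj_iff)
  have "(solution has_derivative inv ?A) (at y)"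
    by (rule has_derivative_inverse_strong_x[OF open_chamber solution_in_chamber
          continuous_holonomy solution_holonomy holonomy_has_derivative[OF solution_in_chamber] A
          holonomy_solution])
  then show ?thesis using that A by (metis comp_apply id_apply)
qed

section \<open>Positivity of solutions of the linearised system\<close>

text \<open>
  This is what makes the tangent vectors positive. The minimum \<open>\<mu>\<close> of \<open>v\<close>, if it is not positive, is
  attained at some start \<open>j\<close>, because at an inner index the equation is a discrete maximum principle,
  which passes a nonpositive minimum on to the preceding index. Going backwards from \<open>j\<close>, the equation
  at \<open>j\<close> makes \<open>v\<close> jump up by at least \<open>1 - \<mu>\<close>; the convexity expressed by the inner equations preserves
  this slope as long as no start is met; and the equation at the next start then forces the value before
  it below \<open>\<mu>\<close>.
\<close>

lemma positive_solution:
  assumes "\<And>i. d i > 0" and eq: "\<And>i. d i * v $ i + coupling v $ i = start_vector $ i"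
  shows "v $ i > 0"
proof (rule ccontr)
  assume neg: "\<not> v $ i > 0"
  define \<mu> where "\<mu> = Min (range (\<lambda>i. v $ i))"
  have \<mu>: "\<mu> \<le> v $ i" for i by (simp add: \<mu>_def)
  have "\<mu> \<le> 0" using neg \<mu>[of i] by linarith
  have "\<mu> \<in> range (\<lambda>i. v $ i)" unfolding \<mu>_def by (rule Min_in) auto
  then obtain k where k: "v $ k = \<mu>" by auto
  have inner: "v $ pv i = (2 + d i) * v $ i - v $ nx i" if "i \<notin> S" for i
    using eq[of i] that by (simp add: coupling_def start_vector_def algebra_simps)
  have start: "v $ pv i = 1 + v $ nx i - (1 + d i) * v $ i" if "i \<in> S" for i
    using eq[of i] that by (simp add: coupling_def start_vector_def algebra_simps)
  have "v $ ((pv ^^ m) k) = \<mu> \<or> (\<exists>j\<in>S. v $ j = \<mu>)" for m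
  proof (induction m)
    case (Suc m)
    let ?i = "(pv ^^ m) k"
    show ?case
    proof (cases "v $ ?i = \<mu> \<and> ?i \<notin> S")
      case True
      then have eqi: "v $ pv ?i + v $ nx ?i = 2 * \<mu> + d ?i * \<mu>"
        using inner[of ?i] by (simp add: algebra_simps)
      have "d ?i * \<mu> \<le> 0" using assms(1)[of ?i] \<open>\<mu> \<le> 0\<close> by (simp add: mult_nonneg_nonpos)
      then have "v $ pv ?i = \<mu>" using eqi \<mu>[of "pv ?i"] \<mu>[of "nx ?i"] by linarith
      then show ?thesis by simp
    qed (use Suc in auto)
  qed (simp add: k)
  then obtain j where j: "j \<in> S" "v $ j = \<mu>" using reach_pv[of k] by metis
  have grow: "v $ i - v $ nx i \<ge> 1 - \<mu> \<and> v $ i > 0" if "i = (pv ^^ m) (pv j)"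
    "\<forall>l<m. (pv ^^ l) (pv j) \<notin> S" for m i
    using that
  proof (induction m arbitrary: i)
    case 0
    have "d j * \<mu> \<le> 0" using assms(1)[of j] \<open>\<mu> \<le> 0\<close> by (simp add: mult_nonneg_nonpos)
    then show ?case
      using 0 start[OF j(1)] j(2) \<mu>[of "nx j"] \<open>\<mu> \<le> 0\<close> by (simp add: algebra_simps)
  next
    case (Suc m)
    let ?i = "(pv ^^ m) (pv j)"
    have IH: "v $ ?i - v $ nx ?i \<ge> 1 - \<mu> \<and> v $ ?i > 0" using Suc by simp
    have "?i \<notin> S" using Suc.prems by simp
    from inner[OF this] have "v $ pv ?i - v $ ?i = d ?i * v $ ?i + (v $ ?i - v $ nx ?i)"
      by (simp add: algebra_simps)
    moreover have "d ?i * v $ ?i > 0" using IH assms(1)[of ?i] by simp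
    ultimately have "v $ pv ?i - v $ ?i \<ge> 1 - \<mu>" "v $ pv ?i > 0"
      using IH \<open>\<mu> \<le> 0\<close> by linarith+
    then show ?case using Suc.prems(1) by simp
  qed
  \<comment> \<open>The first start met when going backwards from \<open>j\<close>; it may be \<open>j\<close> itself.\<close>
  define m where "m = (LEAST m. (pv ^^ m) (pv j) \<in> S)"
  let ?i = "(pv ^^ m) (pv j)"
  have iS: "?i \<in> S" unfolding m_def using reach_pv[of "pv j"] by (rule LeastI_ex)
  have "\<forall>l<m. (pv ^^ l) (pv j) \<notin> S" unfolding m_def using not_less_Least by blast
  then have g: "v $ ?i - v $ nx ?i \<ge> 1 - \<mu>" "v $ ?i > 0" using grow by blast+
  have "d ?i * v $ ?i > 0" using g assms(1)[of ?i] by simp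
  then have "v $ pv ?i < \<mu>" using start[OF iS] g by (simp add: algebra_simps)
  then show False using \<mu>[of "pv ?i"] by linarith
qed

section \<open>The solution curve\<close>

definition curve :: "real \<Rightarrow> real^'n" where
  "curve \<eta> = (\<chi> i. exp (solution (\<eta> *\<^sub>R start_vector) $ i))"

lemma range_curve:
  "z \<in> range curve \<longleftrightarrow> (\<forall>i. z $ i > 0 \<and> side (c i) (ln (z $ i))) \<and>
     (\<exists>\<eta>. holonomy (\<chi> i. ln (z $ i)) = \<eta> *\<^sub>R start_vector)"
proof
  assume "z \<in> range curve"
  then obtain \<eta> where z: "z = curve \<eta>" by blast
  then have "(\<chi> i. ln (z $ i)) = solution (\<eta> *\<^sub>R start_vector)"
    by (simp add: curve_def vec_eq_iff)
  moreover have "side (c i) (ln (z $ i))" for i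
    using solution_in_chamber z by (simp add: curve_def chamber_def)
  ultimately show "(\<forall>i. z $ i > 0 \<and> side (c i) (ln (z $ i))) \<and>
     (\<exists>\<eta>. holonomy (\<chi> i. ln (z $ i)) = \<eta> *\<^sub>R start_vector)"
    using z by (auto simp: curve_def)
next
  assume *: "(\<forall>i. z $ i > 0 \<and> side (c i) (ln (z $ i))) \<and>
     (\<exists>\<eta>. holonomy (\<chi> i. ln (z $ i)) = \<eta> *\<^sub>R start_vector)"
  then obtain \<eta> where \<eta>: "holonomy (\<chi> i. ln (z $ i)) = \<eta> *\<^sub>R start_vector" by blast
  have "(\<chi> i. ln (z $ i)) \<in> chamber" using * by (simp add: chamber_def)
  from solution_holonomy[OF this] have "z = curve \<eta>"
    using * by (simp add: curve_def \<eta> vec_eq_iff)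
  then show "z \<in> range curve" by blast
qed

lemma curve_pos: "curve \<eta> $ i > 0"
  by (simp add: curve_def)

lemma holonomy_curve: "holonomy (\<chi> i. ln (curve \<eta> $ i)) = \<eta> *\<^sub>R start_vector"
  by (simp add: curve_def)

text \<open>
  The affine change of parameter \<open>\<kappa> * s + a\<close> provides both the curves based at a given point, used for
  tangent vectors, and the reparametrisation by the logarithm of the puncture length.
\<close>

lemma curve_has_vector_derivative:
  obtains v where
    "\<And>\<kappa> a s. \<kappa> * s + a = \<eta> \<Longrightarrow> ((\<lambda>s. curve (\<kappa> * s + a)) has_vector_derivative
         (\<chi> i. curve \<eta> $ i * (\<kappa> * v $ i))) (at s)"
    "holonomy_deriv (\<chi> i. ln (curve \<eta> $ i)) v = start_vector"
proof -
  let ?y = "\<eta> *\<^sub>R start_vector"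
  obtain D where D: "(solution has_derivative D) (at ?y)"
    "\<And>v. holonomy_deriv (solution ?y) (D v) = v"
    using solution_has_derivative[of ?y] by blast
  define v where "v = D start_vector"
  interpret D: linear D using D(1) has_derivative_linear by blast
  have "((\<lambda>s. curve (\<kappa> * s + a)) has_vector_derivative
         (\<chi> i. curve \<eta> $ i * (\<kappa> * v $ i))) (at s)" if "\<kappa> * s + a = \<eta>" for \<kappa> a s
  proof -
    have "((\<lambda>s. (\<kappa> * s + a) *\<^sub>R start_vector) has_derivative (\<lambda>h. (\<kappa> * h) *\<^sub>R start_vector)) (at s)"
      by (auto intro!: derivative_eq_intros)
    from has_derivative_compose[OF this, of solution D]
    have "((\<lambda>s. solution ((\<kappa> * s + a) *\<^sub>R start_vector)) has_derivative
        (\<lambda>h. (\<kappa> * h) *\<^sub>R v)) (at s)"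
      using D(1) that by (simp add: v_def D.scale)
    from bounded_linear.has_derivative[OF bounded_linear_vec_nth this]
    have "((\<lambda>s. solution ((\<kappa> * s + a) *\<^sub>R start_vector) $ i) has_real_derivative (\<kappa> * v $ i)) (at s)"
      for i unfolding has_field_derivative_def by (rule has_derivative_eq_rhs) auto
    then have "((\<lambda>s. exp (solution ((\<kappa> * s + a) *\<^sub>R start_vector) $ i)) has_real_derivative
        curve \<eta> $ i * (\<kappa> * v $ i)) (at s)" for i
      using that by (auto intro!: derivative_eq_intros simp: curve_def)
    then have "((\<lambda>s. curve (\<kappa> * s + a) $ i) has_derivative
        (\<lambda>h. h * (curve \<eta> $ i * (\<kappa> * v $ i)))) (at s)" for i
      by (simp add: curve_def has_field_derivative_def mult_commute_abs)
    then show ?thesis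
      unfolding has_vector_derivative_def
        has_derivative_componentwise_within[of "\<lambda>s. curve (\<kappa> * s + a)"]
      by (auto simp: Basis_vec_def inner_axis)
  qed
  moreover have "holonomy_deriv (\<chi> i. ln (curve \<eta> $ i)) v = start_vector"
    by (simp add: curve_def v_def D(2))
  ultimately show ?thesis using that by blast
qed

lemma ln_curve_in_chamber: "(\<chi> i. ln (curve \<eta> $ i)) \<in> chamber"
  using solution_in_chamber by (simp add: curve_def)

lemma curve_positive_tangent:
  obtains v where "((\<lambda>s. curve (s + a)) has_vector_derivative v) (at 0)" "\<And>i. v $ i > 0"
proof -
  obtain v where v: "\<And>\<kappa> b s. \<kappa> * s + b = a \<Longrightarrow>
      ((\<lambda>s. curve (\<kappa> * s + b)) has_vector_derivative (\<chi> i. curve a $ i * (\<kappa> * v $ i))) (at s)"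
    "holonomy_deriv (\<chi> i. ln (curve a $ i)) v = start_vector"
    using curve_has_vector_derivative[of a] by blast
  have "v $ i > 0" for i
  proof (rule positive_solution)
    show "log_shape_deriv (c i) (ln (curve a $ i)) > 0" for i
      using log_shape_deriv_pos ln_curve_in_chamber by (simp add: chamber_def)
    show "log_shape_deriv (c i) (ln (curve a $ i)) * v $ i + coupling v $ i = start_vector $ i" for i
      using v(2) by (auto simp: holonomy_deriv_def vec_eq_iff)
  qed
  then show ?thesis
    using v(1)[of 1 0 a] curve_pos by (intro that[of "\<chi> i. curve a $ i * (1 * v $ i)"]) auto
qed

text \<open>
  Differentiating \<open>holonomy t = \<eta> *\<^sub>R start_vector\<close> gives a linear system for the logarithmic derivative
  whose coefficients are rational functions of the point. By Cramer's rule the curve solves an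
  autonomous equation with rational right-hand side, so it is smooth.
\<close>

lemma smooth_curve: "smooth_on UNIV (\<lambda>s. curve (\<kappa> * s + a))"
proof -
  define z where "z s = curve (\<kappa> * s + a)" for s
  have "\<exists>v. (z has_vector_derivative (\<chi> i. z s $ i * (\<kappa> * v $ i))) (at s) \<and>
      holonomy_deriv (\<chi> i. ln (z s $ i)) v = start_vector" for s
  proof -
    obtain v where v: "((\<lambda>s. curve (\<kappa> * s + a)) has_vector_derivative
          (\<chi> i. curve (\<kappa> * s + a) $ i * (\<kappa> * v $ i))) (at s)"
        "holonomy_deriv (\<chi> i. ln (curve (\<kappa> * s + a) $ i)) v = start_vector"
      by (rule curve_has_vector_derivative[of "\<kappa> * s + a"]) blast
    then show ?thesis unfolding z_def by blast
  qed
  then obtain v where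
    v: "\<And>s. (z has_vector_derivative (\<chi> i. z s $ i * (\<kappa> * v s $ i))) (at s)"
      "\<And>s. holonomy_deriv (\<chi> i. ln (z s $ i)) (v s) = start_vector" by metis
  define A where "A s = matrix (holonomy_deriv (\<chi> i. ln (z s $ i)))" for s
  have chamber: "(\<chi> i. ln (z s $ i)) \<in> chamber" for s
    unfolding z_def by (rule ln_curve_in_chamber)
  have zpos: "z s $ i > 0" for s i by (simp add: z_def curve_pos)
  let ?E = "elementary UNIV (range (\<lambda>i s. z s $ i))"
  have z: "?E (\<lambda>s. z s $ i)" for i by (rule elementary.base) blast
  have "?E (\<lambda>s. log_shape_deriv (c i) (ln (z s $ i)))" for i
  proof (cases "c i")
    case R
    have ne: "z s $ i \<noteq> 1" for s
      using chamber[of s] zpos[of s i] R by (auto simp: chamber_def side_def dest: spec[of _ i])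
    have "(\<lambda>s. log_shape_deriv (c i) (ln (z s $ i))) = (\<lambda>s. 2 / (z s $ i - 1))"
    proof
      fix s show "log_shape_deriv (c i) (ln (z s $ i)) = 2 / (z s $ i - 1)"
        using R zpos[of s i] ne[of s] by (simp add: log_shape_deriv_def exp_minus field_simps)
    qed
    moreover have "?E (\<lambda>s. 2 / (z s $ i - 1))"
      using ne by (intro elementary_divide elementary_diff elementary.const z) auto
    ultimately show ?thesis by simp
  next
    case L
    have ne: "z s $ i \<noteq> 1" for s
      using chamber[of s] zpos[of s i] L by (auto simp: chamber_def side_def dest: spec[of _ i])
    have "(\<lambda>s. log_shape_deriv (c i) (ln (z s $ i))) = (\<lambda>s. 2 * z s $ i / (1 - z s $ i))"
      using L zpos by (simp add: log_shape_deriv_def)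
    moreover have "?E (\<lambda>s. 2 * z s $ i / (1 - z s $ i))"
      using ne by (intro elementary_divide elementary_diff elementary.mult elementary.const z)
        (metis eq_iff_diff_eq_0)
    ultimately show ?thesis by simp
  qed
  then have A: "?E (\<lambda>s. A s $ i $ j)" for i j
    unfolding A_def matrix_def holonomy_deriv_def
    by (simp, intro elementary.add elementary.mult elementary.const)
  have detA: "det (A s) \<noteq> 0" for s
    using det_nz_iff_inj[OF linear_holonomy_deriv] holonomy_deriv_inj[OF chamber]
    by (simp add: A_def)
  have "A s *v v s = start_vector" for s
    unfolding A_def using v(2)[of s] by (simp add: matrix_works linear_matrix_vector_mul_eq linear_holonomy_deriv)
  then have vs: "v s = (\<chi> k. det (\<chi> i j. if j = k then start_vector $ i else A s $ i $ j) / det (A s))"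
    for s using cramer[OF detA] by blast
  have "?E (\<lambda>s. v s $ k)" for k
  proof -
    have "?E (\<lambda>s. det (\<chi> i j. if j = k then start_vector $ i else A s $ i $ j) / det (A s))"
    proof (intro elementary_divide elementary_det)
      show "?E (\<lambda>s. (\<chi> i j. if j = k then start_vector $ i else A s $ i $ j) $ i $ j)" for i j
        using A by (cases "j = k") (auto intro: elementary.const)
    qed (use A detA in auto)
    then show ?thesis by (subst vs) simp
  qed
  then have "?E (\<lambda>s. (\<chi> i. z s $ i * (\<kappa> * v s $ i)) $ i)" for i
    by (simp, intro elementary.mult elementary.const z)
  from smooth_solution_curve[OF v(1) this] show ?thesis by (simp add: z_def)
qed

end

section \<open>Letters along the cycle\<close>

lemma block_word_ends:
  assumes "bs \<noteq> []" "\<forall>(m, n) \<in> set bs. m \<ge> 1 \<and> n \<ge> 1"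
  shows "block_word bs \<noteq> [] \<and> hd (block_word bs) = R \<and> last (block_word bs) = L"
  using assms
proof (induction bs)
  case (Cons b bs)
  obtain m n where b: "b = (Suc m, Suc n)"
    using Cons.prems(2) by (cases b) (auto simp: Suc_le_eq gr0_conv_Suc)
  have eq: "block_word (b # bs) = R # replicate m R @ replicate n L @ L # block_word bs"
    by (simp add: block_word_def b replicate_app_Cons_same)
  have "bs = [] \<or> block_word bs \<noteq> [] \<and> last (block_word bs) = L" using Cons by auto
  then show ?case unfolding eq by (auto simp: block_word_def[of "[]"])
qed auto

fun other :: "letter \<Rightarrow> letter" where
  "other R = L"
| "other L = R"

lemma other_eq: "a \<noteq> b \<longleftrightarrow> b = other a"
  by (cases a; cases b) auto

text \<open>
  The parameter whose squares fill the expression of the first edge of a string of letters \<open>a\<close>; the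
  inner edges of the string contain the one for the other letter. The relation \<open>x y z = -1\<close> allows
  everything to be written in terms of one of them.
\<close>

definition letter_shape :: "letter \<Rightarrow> real \<Rightarrow> real" where
  "letter_shape a z = (case a of R \<Rightarrow> (z - 1) / z | L \<Rightarrow> 1 / (1 - z))"

lemma letter_shape_other:
  "z \<noteq> 0 \<Longrightarrow> z \<noteq> 1 \<Longrightarrow> letter_shape (other a) z = - 1 / (z * letter_shape a z)"
  by (cases a) (auto simp: letter_shape_def field_simps)

lemma letter_shape_nonzero: "z \<noteq> 0 \<Longrightarrow> z \<noteq> 1 \<Longrightarrow> letter_shape a z \<noteq> 0"
  by (cases a) (auto simp: letter_shape_def)

lemma letter_shape_other_neg:
  "z > 0 \<Longrightarrow> z \<noteq> 1 \<Longrightarrow> letter_shape (other a) z < 0 \<longleftrightarrow> letter_shape a z > 0"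
  by (cases a) (auto simp: letter_shape_def divide_simps)

lemma letter_shape_sign_cong:
  "y > 0 \<Longrightarrow> y \<noteq> 1 \<Longrightarrow> z > 0 \<Longrightarrow> z \<noteq> 1 \<Longrightarrow> (z < 1 \<longleftrightarrow> y < 1) \<Longrightarrow>
   letter_shape a z < 0 \<longleftrightarrow> letter_shape a y < 0"
  by (cases a) (auto simp: letter_shape_def divide_less_0_iff)

lemma side_ln: "z > 0 \<Longrightarrow> side a (ln z) \<longleftrightarrow> letter_shape a z > 0"
  by (cases a) (auto simp: letter_shape_def side_def zero_less_divide_iff)

lemma log_shape_ln:
  assumes "z > 0" "letter_shape a z > 0"
  shows "log_shape a (ln z) = ln ((letter_shape a z)\<^sup>2)"
proof -
  have "exp (- ln z) = 1 / z" using assms by (simp add: exp_minus field_simps)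
  moreover have "1 - 1 / z = (z - 1) / z" using assms by (simp add: field_simps)
  ultimately show ?thesis
    using assms by (cases a) (auto simp: log_shape_def letter_shape_def ln_realpow ln_div)
qed

lemma prod_list_doubled:
  "prod_list (concat (map (\<lambda>i. [u i, u i]) xs)) = prod_list (map (\<lambda>i. (u i :: real)\<^sup>2) xs)"
  by (induction xs) (auto simp: power2_eq_square)

lemma count_neg_doubled:
  "length (filter (\<lambda>t. t < 0) (concat (map (\<lambda>i. [u i, u i :: real]) xs)))
     = 2 * length (filter (\<lambda>i. u i < 0) xs)"
  by (induction xs) auto

text \<open>
  The inner edge equations of a string say that each squared parameter is a multiplicative second
  difference of \<open>Z\<close>, so that their product along the string only depends on its two ends.
\<close>

lemma telescope_string:
  fixes Z u :: "nat \<Rightarrow> real"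
  assumes Z: "\<And>i. Z i > 0"
    and "j \<le> k" "\<And>i. i \<in> {j+1..k} \<Longrightarrow> (u i)\<^sup>2 * (Z i)\<^sup>2 = Z (i - 1) * Z (i + 1)"
  shows "prod_list (map (\<lambda>i. (u i)\<^sup>2) [Suc j..<Suc k]) = Z j / Z (j + 1) * (Z (k + 1) / Z k)"
  using assms(2,3)
proof (induction k rule: dec_induct)
  case base
  have "Z j \<noteq> 0" "Z (Suc j) \<noteq> 0" using Z by (metis less_irrefl)+
  then show ?case by simp
next
  case (step k)
  have nz: "Z i \<noteq> 0" for i using Z by (metis less_irrefl)
  have "(u (Suc k))\<^sup>2 = Z k * Z (k + 2) / (Z (k + 1))\<^sup>2"
    using step.prems[of "Suc k"] step.hyps nz[of "Suc k"] by (simp add: field_simps)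
  moreover have "prod_list (map (\<lambda>i. (u i)\<^sup>2) [Suc j..<Suc k]) = Z j / Z (j + 1) * (Z (k + 1) / Z k)"
    using step by simp
  moreover have "[Suc j..<Suc (Suc k)] = [Suc j..<Suc k] @ [Suc k]" using step.hyps by simp
  ultimately show ?case
    using nz by (simp add: power2_eq_square del: upt_Suc)
qed

text \<open>
  A word that starts with \<open>R\<close> and ends with \<open>L\<close>: its maximal strings remain maximal when the word is
  read cyclically.
\<close>

locale monodromy_cycle =
  fixes w :: "letter list" and e :: "nat \<Rightarrow> 'n::finite"
  assumes w_nonempty: "w \<noteq> []" and w_first: "hd w = R" and w_last: "last w = L"
    and labelling: "cyclic_labelling (length w) e"
begin

abbreviation N where "N \<equiv> length w"

text \<open>
  The letter at a position counted from 1 and read modulo \<open>N\<close>, so that position 0 is position \<open>N\<close>.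
\<close>

definition letter_at :: "nat \<Rightarrow> letter" where "letter_at i = w ! ((i + N - 1) mod N)"

definition pos :: "'n \<Rightarrow> nat" where "pos c = (SOME i. i \<in> {1..N} \<and> e i = c)"
definition nx :: "'n \<Rightarrow> 'n" where "nx c = e (pos c + 1)"
definition pv :: "'n \<Rightarrow> 'n" where "pv c = e (pos c - 1)"
definition letter_of :: "'n \<Rightarrow> letter" where "letter_of c = letter_at (pos c)"
definition starts :: "'n set" where "starts = {c. letter_of c \<noteq> letter_of (pv c)}"

lemma N_pos: "N \<ge> 1"
  using w_nonempty by (simp add: Suc_le_eq)

lemma e_eq: "e i = e j \<longleftrightarrow> i mod N = j mod N"
  using labelling by (simp add: cyclic_labelling_def)

lemma pos: "pos c \<in> {1..N}" "e (pos c) = c"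
proof -
  have "\<exists>i. i \<in> {1..N} \<and> e i = c"
  proof -
    obtain j where j: "c = e j" using labelling unfolding cyclic_labelling_def by blast
    show ?thesis
    proof (cases "j mod N = 0")
      case True
      then have "e N = c" using j e_eq by simp
      then show ?thesis using N_pos by auto
    next
      case False
      then have "j mod N \<in> {1..N}" using N_pos by (simp add: Suc_le_eq mod_less_divisor less_imp_le)
      moreover have "e (j mod N) = c" using j e_eq by simp
      ultimately show ?thesis by blast
    qed
  qed
  from someI_ex[OF this] show "pos c \<in> {1..N}" "e (pos c) = c" by (auto simp: pos_def)
qed

lemma letter_at_nth: "1 \<le> i \<Longrightarrow> i \<le> N \<Longrightarrow> letter_at i = w ! (i - 1)"
proof -
  assume i: "1 \<le> i" "i \<le> N"
  then have "i + N - 1 = (i - 1) + N" by simp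
  then have "(i + N - 1) mod N = ((i - 1) + N) mod N" by (rule arg_cong)
  also have "\<dots> = i - 1" by (subst mod_add_self2) (use i in simp)
  finally have "(i + N - 1) mod N = i - 1" .
  then show ?thesis by (simp add: letter_at_def)
qed

lemma shift:
  assumes "e i = e j"
  shows "e (i + k) = e (j + k)" "letter_at i = letter_at j"
proof -
  have m: "i mod N = j mod N" using assms e_eq by simp
  then show "e (i + k) = e (j + k)" using e_eq by (metis mod_add_left_eq)
  have "(i + (N - 1)) mod N = (j + (N - 1)) mod N" using m by (metis mod_add_left_eq)
  then show "letter_at i = letter_at j" using N_pos by (simp add: letter_at_def)
qed

lemma nx_e [simp]: "nx (e i) = e (Suc i)"
  unfolding nx_def using shift(1)[of "pos (e i)" i 1] pos(2) by simp

lemma pv_e [simp]: "pv (e (Suc i)) = e i"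
proof -
  let ?p = "pos (e (Suc i))"
  have p: "?p \<in> {1..N}" "e ?p = e (Suc i)" using pos by auto
  then have "e (?p + (N - 1)) = e (Suc i + (N - 1))" using shift(1) by blast
  moreover have "e (?p + (N - 1)) = e (?p - 1)"
  proof -
    have "?p + (N - 1) = (?p - 1) + N" using p N_pos by auto
    then show ?thesis using e_eq by simp
  qed
  moreover have "e (Suc i + (N - 1)) = e i"
  proof -
    have "Suc i + (N - 1) = i + N" using N_pos by simp
    then have "e (Suc i + (N - 1)) = e (i + N)" by (rule arg_cong)
    then show ?thesis by (simp add: e_eq)
  qed
  ultimately show ?thesis by (simp add: pv_def)
qed

lemma letter_of_e [simp]: "letter_of (e i) = letter_at i"
  unfolding letter_of_def using shift(2) pos(2) by blast

lemma cases_index: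
  obtains i where "c = e (Suc i)" "i < N"
proof -
  have "pos c = Suc (pos c - 1)" "pos c - 1 < N" using pos(1)[of c] by auto
  then show ?thesis using that pos(2) by metis
qed

lemma start_Suc: "e (Suc i) \<in> starts \<longleftrightarrow> letter_at (Suc i) \<noteq> letter_at i"
  by (simp add: starts_def)

lemma e_N: "e N = e 0" "e (Suc N) = e 1"
proof -
  show "e N = e 0" by (simp add: e_eq)
  from shift(1)[OF this, of 1] show "e (Suc N) = e 1" by simp
qed

lemma letter_at_0: "letter_at 0 = L" and letter_at_1: "letter_at 1 = R"
proof -
  have "letter_at N = L" using letter_at_nth[of N] N_pos w_last w_nonempty by (simp add: last_conv_nth)
  then show "letter_at 0 = L" using shift(2)[OF e_N(1)] by simp
  show "letter_at 1 = R" using letter_at_nth[of 1] N_pos w_first w_nonempty by (simp add: hd_conv_nth)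
qed

lemma start_1: "e 1 \<in> starts"
  using start_Suc[of 0] letter_at_0 letter_at_1 by simp

lemma nx_pv: "nx (pv c) = c" and pv_nx: "pv (nx c) = c"
proof -
  obtain i where "c = e (Suc i)" using cases_index[of c] by blast
  then show "nx (pv c) = c" "pv (nx c) = c" by auto
qed

lemma nx_funpow: "(nx ^^ m) (e i) = e (i + m)"
  by (induction m) auto

lemma pv_funpow: "m \<le> i \<Longrightarrow> (pv ^^ m) (e i) = e (i - m)"
proof (induction m)
  case (Suc m)
  then have "i - m = Suc (i - Suc m)" by simp
  then have "pv (e (i - m)) = e (i - Suc m)" using pv_e by metis
  then show ?case using Suc by simp
qed simp

lemma reach_start: "\<exists>m. (nx ^^ m) c \<in> starts" "\<exists>m. (pv ^^ m) c \<in> starts"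
proof -
  obtain i where i: "c = e (Suc i)" "i < N" using cases_index by blast
  have "(nx ^^ (N - i)) c = e (Suc N)" using i nx_funpow[of "N - i" "Suc i"] by simp
  then show "\<exists>m. (nx ^^ m) c \<in> starts" using e_N start_1 by metis
  have "(pv ^^ i) c = e 1" using i pv_funpow[of i "Suc i"] by simp
  then show "\<exists>m. (pv ^^ m) c \<in> starts" using start_1 by metis
qed

text \<open>
  The position after a maximal string is always a start: after position \<open>N\<close> it is position 1 by
  cyclicity.
\<close>

lemma maximal_stringD:
  assumes "maximal_string w a j k"
  shows "1 \<le> j" "j \<le> k" "k \<le> N" "\<And>i. i \<in> {j..k} \<Longrightarrow> letter_at i = a"
    "e j \<in> starts" "e (Suc k) \<in> starts" "\<And>i. i \<in> {j+1..k} \<Longrightarrow> e i \<notin> starts"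
proof -
  show jk: "1 \<le> j" "j \<le> k" "k \<le> N" using assms by (auto simp: maximal_string_def)
  show a: "letter_at i = a" if "i \<in> {j..k}" for i
    using assms that jk by (simp add: maximal_string_def letter_at_nth)
  show "e j \<in> starts"
  proof (cases "j = 1")
    case True then show ?thesis using start_1 by simp
  next
    case False
    then obtain i where i: "j = Suc (Suc i)" using jk(1) by (metis One_nat_def not0_implies_Suc not_one_le_zero)
    then have "letter_at (Suc i) \<noteq> a" using assms jk by (simp add: maximal_string_def letter_at_nth)
    then show ?thesis using i a[of j] jk start_Suc by simp
  qed
  show "e (Suc k) \<in> starts"
  proof (cases "k = N")
    case True then show ?thesis using start_1 e_N by simp
  next
    case False
    then have "letter_at (Suc k) \<noteq> a" using assms jk by (simp add: maximal_string_def letter_at_nth)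
    then show ?thesis using a[of k] jk start_Suc by simp
  qed
  show "e i \<notin> starts" if i: "i \<in> {j+1..k}" for i
  proof -
    obtain l where "i = Suc l" using i by (cases i) auto
    then show ?thesis using a[of i] a[of l] i start_Suc by simp
  qed
qed

lemma maximal_string_from_start:
  assumes "e j \<in> starts" "1 \<le> j" "j \<le> N"
  obtains k where "maximal_string w (letter_at j) j k"
proof -
  define P where "P k \<longleftrightarrow> j \<le> k \<and> (k = N \<or> letter_at (Suc k) \<noteq> letter_at j)" for k
  define k where "k = (LEAST k. P k)"
  have "P N" using assms by (simp add: P_def)
  then have k: "P k" "k \<le> N" unfolding k_def by (auto intro: LeastI Least_le)
  have below: "\<not> P i" if "i < k" for i using that not_less_Least unfolding k_def by blast
  have letter_at: "letter_at i = letter_at j" if "j \<le> i" "i \<le> k" for i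
    using that
  proof (induction i rule: dec_induct)
    case (step i)
    then show ?case using below[of i] by (simp add: P_def)
  qed simp
  have "maximal_string w (letter_at j) j k"
    unfolding maximal_string_def
  proof (intro conjI ballI)
    show "w ! (i - 1) = letter_at j" if "i \<in> {j..k}" for i
      using letter_at[of i] letter_at_nth[of i] that assms k by auto
    show "j = 1 \<or> w ! (j - 2) \<noteq> letter_at j"
    proof (cases "j = 1")
      case False
      then obtain i where i: "j = Suc (Suc i)" using assms(2) by (metis One_nat_def not0_implies_Suc not_one_le_zero)
      then show ?thesis using assms start_Suc letter_at_nth[of "Suc i"] by simp
    qed simp
    show "k = N \<or> w ! k \<noteq> letter_at j" using k letter_at_nth[of "Suc k"] by (auto simp: P_def)
  qed (use assms k P_def in auto)
  then show ?thesis using that by blast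
qed

lemma in_maximal_string:
  assumes "1 \<le> q" "q \<le> N"
  obtains a j k where "maximal_string w a j k" "q \<in> {j..k}"
proof -
  define j where "j = (GREATEST i. i \<le> q \<and> e i \<in> starts \<and> 1 \<le> i)"
  have ex: "1 \<le> q \<and> e 1 \<in> starts \<and> (1::nat) \<le> 1" using assms start_1 by simp
  have j: "j \<le> q" "e j \<in> starts" "1 \<le> j"
    using GreatestI_nat[of "\<lambda>i. i \<le> q \<and> e i \<in> starts \<and> 1 \<le> i" 1 q] ex by (auto simp: j_def)
  have greatest: "i \<le> j" if "i \<le> q" "e i \<in> starts" "1 \<le> i" for i
    using Greatest_le_nat[of "\<lambda>i. i \<le> q \<and> e i \<in> starts \<and> 1 \<le> i" i q] that by (auto simp: j_def)
  obtain k where k: "maximal_string w (letter_at j) j k"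
    using maximal_string_from_start[of j] j assms by auto
  have "q \<le> k"
  proof (rule ccontr)
    assume "\<not> q \<le> k"
    then have "Suc k \<le> j" using greatest[of "Suc k"] maximal_stringD(6)[OF k] by simp
    then show False using maximal_stringD(2)[OF k] by simp
  qed
  then show ?thesis using that[OF k] j by simp
qed

lemma maximal_string_before:
  assumes "e (Suc p) \<in> starts" "1 \<le> p" "p < N"
  obtains a j where "maximal_string w a j p"
proof -
  obtain a j k where k: "maximal_string w a j k" "p \<in> {j..k}"
    using in_maximal_string[of p] assms by auto
  have "\<not> Suc p \<le> k" using maximal_stringD(7)[OF k(1), of "Suc p"] assms(1) k(2) by auto
  then have "k = p" using k(2) by simp
  then show ?thesis using k that by blast
qed

section \<open>Edge conditions\<close>

text \<open>
  The edge conditions in terms of the cyclic neighbours of a single index. At starts no condition holds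
  for one index alone; instead \<open>start_value\<close> and \<open>start_neg\<close> turn out to be the same at all starts.
\<close>

definition inner_eq :: "real^'n \<Rightarrow> 'n \<Rightarrow> bool" where
  "inner_eq z c \<longleftrightarrow> letter_shape (letter_of c) (z $ c) > 0 \<and>
     (letter_shape (letter_of c) (z $ c))\<^sup>2 * (z $ c)\<^sup>2 = z $ pv c * z $ nx c"

definition start_value :: "real^'n \<Rightarrow> 'n \<Rightarrow> real" where
  "start_value z c = (letter_shape (letter_of c) (z $ c))\<^sup>2 * z $ pv c * z $ c / z $ nx c"

definition start_neg :: "real^'n \<Rightarrow> 'n \<Rightarrow> bool" where
  "start_neg z c \<longleftrightarrow> letter_shape (letter_of c) (z $ c) < 0"

lemma shape_letter_shape: "(case a of R \<Rightarrow> shape_x e z | L \<Rightarrow> shape_y e z) i = letter_shape a (z $ e i)"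
  "(case a of R \<Rightarrow> shape_y e z | L \<Rightarrow> shape_x e z) i = letter_shape (other a) (z $ e i)"
  by (cases a; simp add: shape_x_def shape_y_def shape_z_def letter_shape_def)+

lemma inner_edge_iff:
  assumes z: "\<And>i. z $ i > 0 \<and> z $ i \<noteq> 1" and a: "letter_at (Suc q) = a"
  shows "edge_condition (inner_edge a (Suc q) e z) \<longleftrightarrow> inner_eq z (e (Suc q))"
proof -
  let ?u = "letter_shape a (z $ e (Suc q))" and ?v = "letter_shape (other a) (z $ e (Suc q))"
  let ?z = "z $ e (Suc q)"
  have nz: "?z > 0" "?z \<noteq> 1" "z $ e q > 0" "z $ e (Suc (Suc q)) > 0" using z by auto
  have u: "?u \<noteq> 0" using letter_shape_nonzero nz by simp
  have v: "?v * ?v = 1 / (?u\<^sup>2 * ?z\<^sup>2)"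
    using letter_shape_other[of ?z a] nz u by (simp add: power2_eq_square)
  have edge: "inner_edge a (Suc q) e z = [z $ e q, ?v, ?v, z $ e (Suc (Suc q))]"
    by (simp add: inner_edge_def Let_def shape_letter_shape shape_z_def)
  have "prod_list [z $ e q, ?v, ?v, z $ e (Suc (Suc q))] = (z $ e q * z $ e (Suc (Suc q))) * (?v * ?v)"
    by (simp add: mult_ac)
  also have "\<dots> = (z $ e q * z $ e (Suc (Suc q))) / (?u\<^sup>2 * ?z\<^sup>2)"
    by (simp add: v)
  finally have "prod_list [z $ e q, ?v, ?v, z $ e (Suc (Suc q))] = 1 \<longleftrightarrow>
      ?u\<^sup>2 * ?z\<^sup>2 = z $ e q * z $ e (Suc (Suc q))"
    using u nz by (auto simp: divide_eq_1_iff)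
  moreover have "length (filter (\<lambda>t. t < 0) [z $ e q, ?v, ?v, z $ e (Suc (Suc q))]) = 2 \<longleftrightarrow> ?u > 0"
    using nz letter_shape_other_neg[of ?z a] by auto
  ultimately show ?thesis
    unfolding edge edge_condition_def inner_eq_def using a by auto
qed

text \<open>
  By telescoping, the expression of the first edge is a quotient of two quantities, each attached to one
  end of the string. Expressed through the letter of the string that begins there, the quantity at the
  far end is the same as the one at the near end, so the equation says that \<open>start_value\<close> does not change
  from one start to the next. Exactly one of the two ends has a negative parameter for the letter of the
  string; passing to the other letter reverses the sign, which turns this alternation into constancy of
  \<open>start_neg\<close>.
\<close>

lemma first_edge_iff:
  assumes z: "\<And>i. z $ i > 0 \<and> z $ i \<noteq> 1"
    and ms: "maximal_string w a (Suc j) k"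
    and inner: "\<And>i. i \<in> {Suc j + 1..k} \<Longrightarrow> inner_eq z (e i)"
  shows "edge_condition (first_edge a (Suc j) k e z) \<longleftrightarrow>
     (start_neg z (e (Suc j)) \<longleftrightarrow> start_neg z (e (Suc k))) \<and>
     start_value z (e (Suc j)) = start_value z (e (Suc k))"
proof -
  note D = maximal_stringD[OF ms]
  define Z where "Z i = z $ e i" for i
  define u where "u i = letter_shape a (Z i)" for i
  have Z: "Z i > 0" "Z i \<noteq> 1" "Z i \<noteq> 0" for i using z[of "e i"] by (auto simp: Z_def)
  have letters: "letter_at (Suc j) = a" "letter_at (Suc k) = other a"
    using D(2) D(4)[of "Suc j"] D(4)[of k] D(6) start_Suc[of k] by (auto simp: other_eq[symmetric])
  have u_inner: "u i > 0" "(u i)\<^sup>2 * (Z i)\<^sup>2 = Z (i - 1) * Z (i + 1)" if i: "i \<in> {Suc j + 1..k}" for i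
  proof -
    obtain l where l: "i = Suc l" using i by (cases i) auto
    show "u i > 0" "(u i)\<^sup>2 * (Z i)\<^sup>2 = Z (i - 1) * Z (i + 1)"
      using inner[OF i] D(4)[of i] i by (auto simp: l inner_eq_def u_def Z_def)
  qed
  have u0: "u i \<noteq> 0" for i using letter_shape_nonzero Z by (simp add: u_def)
  have "[Suc j..<Suc (Suc k)] = Suc j # [Suc (Suc j)..<Suc k] @ [Suc k]"
    using D(2) by (simp add: upt_conv_Cons)
  then have edge: "first_edge a (Suc j) k e z = [Z j] @ concat (map (\<lambda>i. [u i, u i])
      (Suc j # [Suc (Suc j)..<Suc k] @ [Suc k])) @ [Z (Suc (Suc k))]"
    by (simp add: first_edge_def Let_def shape_letter_shape shape_z_def u_def Z_def del: upt_Suc)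
  have vk: "(letter_shape (other a) (Z (Suc k)))\<^sup>2 = 1 / ((Z (Suc k))\<^sup>2 * (u (Suc k))\<^sup>2)"
    using letter_shape_other[of "Z (Suc k)" a] Z by (simp add: u_def power_divide power_mult_distrib)
  have sv: "start_value z (e (Suc j)) = (u (Suc j))\<^sup>2 * Z j * Z (Suc j) / Z (Suc (Suc j))"
    "start_value z (e (Suc k)) = Z k / ((u (Suc k))\<^sup>2 * Z (Suc k) * Z (Suc (Suc k)))"
    using letters vk Z u0 by (simp_all add: start_value_def u_def Z_def power2_eq_square)
  have "prod_list (map (\<lambda>i. (u i)\<^sup>2) [Suc (Suc j)..<Suc k])
      = Z (Suc j) / Z (Suc j + 1) * (Z (k + 1) / Z k)"
    using telescope_string[of Z "Suc j" k u] Z D(2) u_inner by blast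
  then have "prod_list (first_edge a (Suc j) k e z) =
      Z j * (u (Suc j))\<^sup>2 * (Z (Suc j) / Z (Suc (Suc j)) * (Z (Suc k) / Z k)) * (u (Suc k))\<^sup>2 * Z (Suc (Suc k))"
    unfolding edge by (simp add: prod_list_doubled power2_eq_square del: upt_Suc)
  also have "\<dots> = start_value z (e (Suc j)) / start_value z (e (Suc k))"
    using Z u0 by (simp add: sv)
  finally have "prod_list (first_edge a (Suc j) k e z)
      = start_value z (e (Suc j)) / start_value z (e (Suc k))" .
  moreover have "start_value z (e (Suc k)) \<noteq> 0" using Z u0 by (simp add: sv(2))
  ultimately have prod: "prod_list (first_edge a (Suc j) k e z) = 1 \<longleftrightarrow>
      start_value z (e (Suc j)) = start_value z (e (Suc k))"
    by auto
  have none: "filter (\<lambda>i. u i < 0) [Suc (Suc j)..<Suc k] = []"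
    using u_inner(1) by (force simp: filter_empty_conv)
  have "length (filter (\<lambda>t. t < 0) (first_edge a (Suc j) k e z))
     = (if u (Suc j) < 0 then 2 else 0) + (if u (Suc k) < 0 then 2 else 0)"
    using Z(1)[of j] Z(1)[of "Suc (Suc k)"] none
    unfolding edge by (simp add: count_neg_doubled del: upt_Suc)
  moreover have "letter_shape (other a) (Z (Suc k)) < 0 \<longleftrightarrow> \<not> u (Suc k) < 0"
    using letter_shape_other_neg[of "Z (Suc k)" a] Z u0[of "Suc k"] unfolding u_def by auto
  ultimately have "length (filter (\<lambda>t. t < 0) (first_edge a (Suc j) k e z)) = 2 \<longleftrightarrow>
      (start_neg z (e (Suc j)) \<longleftrightarrow> start_neg z (e (Suc k)))"
    using letters by (auto simp: start_neg_def u_def Z_def)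
  with prod show ?thesis by (auto simp: edge_condition_def)
qed

text \<open>
  Propagating the conditions on the first edges from start to start through the whole word leaves one
  sign \<open>b\<close>, which will distinguish the two components, and one real number \<open>h\<close>, which will be their
  parameter.
\<close>

lemma V_plus_iff:
  "z \<in> V_plus w e \<longleftrightarrow> (\<forall>c. z $ c > 0 \<and> z $ c \<noteq> 1) \<and> (\<forall>c. c \<notin> starts \<longrightarrow> inner_eq z c) \<and>
     (\<exists>b h. \<forall>c\<in>starts. (start_neg z c \<longleftrightarrow> b) \<and> start_value z c = h)"
proof (cases "\<forall>c. z $ c > 0 \<and> z $ c \<noteq> 1")
  case True
  then have z: "\<And>i. z $ i > 0 \<and> z $ i \<noteq> 1" "\<And>i. z $ i \<noteq> 0" by (auto, metis less_irrefl)
  have "z \<in> V_plus w e \<longleftrightarrow> (\<forall>a j k. maximal_string w a j k \<longrightarrow>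
            edge_condition (first_edge a j k e z) \<and>
            (\<forall>q\<in>{j+1..k}. edge_condition (inner_edge a q e z)))"
    using z by (simp add: V_plus_def deformation_variety_def)
  also have "\<dots> \<longleftrightarrow> (\<forall>c. c \<notin> starts \<longrightarrow> inner_eq z c) \<and>
     (\<exists>b h. \<forall>c\<in>starts. (start_neg z c \<longleftrightarrow> b) \<and> start_value z c = h)" (is "?l \<longleftrightarrow> ?r")
  proof
    assume l: ?l
    have inner: "inner_eq z (e i)" if ms: "maximal_string w a j k" and i: "i \<in> {j+1..k}" for a j k i
    proof -
      obtain q where q: "i = Suc q" using i by (cases i) auto
      have "letter_at i = a" using maximal_stringD(4)[OF ms] i by auto
      then show ?thesis using inner_edge_iff[OF z(1), of q a] l ms i q by blast
    qed
    have first: "(start_neg z (e j) \<longleftrightarrow> start_neg z (e (Suc k))) \<and> start_value z (e j) = start_value z (e (Suc k))"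
      if ms: "maximal_string w a j k" for a j k
    proof -
      obtain i where i: "j = Suc i" using maximal_stringD(1)[OF ms] by (cases j) auto
      show ?thesis using first_edge_iff[OF z(1), of a i k] ms inner[OF ms] l i by blast
    qed
    have "inner_eq z c" if c: "c \<notin> starts" for c
    proof -
      obtain i where i: "c = e (Suc i)" "i < N" using cases_index by blast
      then obtain a j k where ms: "maximal_string w a j k" "Suc i \<in> {j..k}"
        using in_maximal_string[of "Suc i"] by auto
      have "Suc i \<noteq> j" using maximal_stringD(5)[OF ms(1)] c i by auto
      then show ?thesis using inner[OF ms(1), of "Suc i"] ms(2) i by auto
    qed
    moreover have const: "(start_neg z (e (Suc i)) \<longleftrightarrow> start_neg z (e 1)) \<and>
        start_value z (e (Suc i)) = start_value z (e 1)" if "i < N" "e (Suc i) \<in> starts" for i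
      using that
    proof (induction i rule: less_induct)
      case (less i)
      show ?case
      proof (cases "i = 0")
        case False
        then obtain a j where ms: "maximal_string w a j i"
          using maximal_string_before[of i] less.prems by auto
        obtain l where "j = Suc l" using maximal_stringD(1)[OF ms] by (cases j) auto
        then show ?thesis
          using first[OF ms] less.IH[of l] maximal_stringD(2,3,5)[OF ms] by auto
      qed simp
    qed
    have "\<forall>c\<in>starts. (start_neg z c \<longleftrightarrow> start_neg z (e 1)) \<and> start_value z c = start_value z (e 1)"
      using const cases_index by metis
    ultimately show ?r by blast
  next
    assume r: ?r
    show ?l
    proof (intro allI impI conjI ballI)
      fix a j k assume ms: "maximal_string w a j k"
      note D = maximal_stringD[OF ms]
      obtain i where i: "j = Suc i" using D(1) by (cases j) auto
      have inner: "inner_eq z (e q)" if "q \<in> {j+1..k}" for q using r D(7)[OF that] by blast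
      show "edge_condition (first_edge a j k e z)"
        using first_edge_iff[OF z(1), of a i k] ms inner r D(5,6) i by metis
      fix q assume q: "q \<in> {j+1..k}"
      then obtain l where "q = Suc l" by (cases q) auto
      then show "edge_condition (inner_edge a q e z)"
        using inner_edge_iff[OF z(1), of l a] inner[OF q] D(4)[of q] q by auto
    qed
  qed
  finally show ?thesis using True by blast
next
  case False
  then show ?thesis by (auto simp: V_plus_def deformation_variety_def)
qed


end

section \<open>The two solution curves\<close>

text \<open>
  If the parameters at the starts are negative, then the parameters for the other letter are positive
  there. Inverting the equation at the starts by \<open>x y z = -1\<close> exchanges the two neighbours, so these
  solutions belong to the same normalised system with the cycle traversed backwards and with the sign of
  \<open>\<eta>\<close> reversed: \<open>\<eta> = ln h\<close> in the first case and \<open>\<eta> = - ln h\<close> in the second.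
\<close>

definition (in monodromy_cycle) down_letter :: "'n \<Rightarrow> letter" where
  "down_letter c = (if c \<in> starts then other (letter_of c) else letter_of c)"

sublocale monodromy_cycle \<subseteq> up: string_cycle nx pv starts letter_of
  by unfold_locales (simp_all add: nx_pv pv_nx reach_start)

sublocale monodromy_cycle \<subseteq> down: string_cycle pv nx starts down_letter
  by unfold_locales (simp_all add: nx_pv pv_nx reach_start)

context monodromy_cycle
begin

abbreviation domain where "domain \<equiv> {z :: real^'n. \<forall>c. z $ c > 0 \<and> z $ c \<noteq> 1}"

lemma start_value_pos: "z \<in> domain \<Longrightarrow> start_value z c > 0"
  using letter_shape_nonzero[of "z $ c" "letter_of c"] by (simp add: start_value_def less_imp_neq[symmetric])

lemma ln_start_value:
  "z \<in> domain \<Longrightarrow> ln (start_value z c) =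
     ln ((letter_shape (letter_of c) (z $ c))\<^sup>2) + ln (z $ pv c) + ln (z $ c) - ln (z $ nx c)"
  using letter_shape_nonzero[of "z $ c" "letter_of c"]
  by (simp add: start_value_def ln_div ln_mult less_imp_neq[symmetric])

lemma inner_eq_ln:
  assumes "z \<in> domain" "letter_shape (letter_of c) (z $ c) > 0"
  shows "inner_eq z c \<longleftrightarrow>
     ln ((letter_shape (letter_of c) (z $ c))\<^sup>2) + 2 * ln (z $ c) - ln (z $ pv c) - ln (z $ nx c) = 0"
proof -
  let ?u = "letter_shape (letter_of c) (z $ c)"
  have pos: "z $ i > 0" for i using assms by simp
  have "inner_eq z c \<longleftrightarrow> ?u\<^sup>2 * (z $ c)\<^sup>2 = z $ pv c * z $ nx c"
    using assms(2) by (simp add: inner_eq_def)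
  also have "\<dots> \<longleftrightarrow> ln (?u\<^sup>2 * (z $ c)\<^sup>2) = ln (z $ pv c * z $ nx c)"
    using pos assms(2) by (intro ln_inj_iff[symmetric] mult_pos_pos zero_less_power)
  also have "\<dots> \<longleftrightarrow> ln (?u\<^sup>2) + 2 * ln (z $ c) = ln (z $ pv c) + ln (z $ nx c)"
    using pos assms(2) by (simp add: ln_mult ln_realpow less_imp_neq[symmetric])
  finally show ?thesis by auto
qed

lemma ln_letter_shape_other:
  assumes "z > 0" "z \<noteq> 1"
  shows "ln ((letter_shape (other a) z)\<^sup>2) = - ln ((letter_shape a z)\<^sup>2) - 2 * ln z"
proof -
  have "letter_shape a z \<noteq> 0" using letter_shape_nonzero assms by simp
  moreover have "(letter_shape (other a) z)\<^sup>2 = inverse (z\<^sup>2 * (letter_shape a z)\<^sup>2)"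
    using letter_shape_other[of z a] assms by (simp add: power_mult_distrib divide_inverse power_inverse)
  ultimately show ?thesis
    using assms by (simp add: ln_inverse ln_mult ln_realpow)
qed

lemma range_up_curve:
  "z \<in> range up.curve \<longleftrightarrow> z \<in> domain \<and> (\<forall>c. c \<notin> starts \<longrightarrow> inner_eq z c) \<and>
     (\<exists>h. \<forall>c\<in>starts. \<not> start_neg z c \<and> start_value z c = h)"
proof (cases "z \<in> domain \<and> (\<forall>c. letter_shape (letter_of c) (z $ c) > 0)")
  case True
  then have z: "z \<in> domain" and u: "\<And>c. letter_shape (letter_of c) (z $ c) > 0" by auto
  have pos: "z $ i > 0" for i using z by simp
  have hol: "up.holonomy (\<chi> i. ln (z $ i)) $ c =
     (if c \<in> starts then ln (start_value z c)
      else ln ((letter_shape (letter_of c) (z $ c))\<^sup>2) + 2 * ln (z $ c) - ln (z $ pv c) - ln (z $ nx c))" for c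
    using pos u z by (simp add: up.holonomy_def up.coupling_def log_shape_ln ln_start_value)
  have "z \<in> range up.curve \<longleftrightarrow> (\<exists>\<eta>. up.holonomy (\<chi> i. ln (z $ i)) = \<eta> *\<^sub>R up.start_vector)"
    unfolding up.range_curve using pos u by (simp add: side_ln)
  also have "\<dots> \<longleftrightarrow> (\<exists>\<eta>. (\<forall>c. c \<notin> starts \<longrightarrow> inner_eq z c) \<and> (\<forall>c\<in>starts. ln (start_value z c) = \<eta>))"
    using inner_eq_ln[OF z u] by (auto simp: vec_eq_iff hol up.start_vector_def)
  also have "\<dots> \<longleftrightarrow> (\<forall>c. c \<notin> starts \<longrightarrow> inner_eq z c) \<and> (\<exists>h. \<forall>c\<in>starts. start_value z c = h)"
    using start_value_pos[OF z] by (metis exp_ln)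
  also have "\<dots> \<longleftrightarrow> (\<forall>c. c \<notin> starts \<longrightarrow> inner_eq z c) \<and>
      (\<exists>h. \<forall>c\<in>starts. \<not> start_neg z c \<and> start_value z c = h)"
    using u by (simp add: start_neg_def not_less less_imp_le)
  finally show ?thesis using z by blast
next
  case False
  have "z \<notin> range up.curve"
  proof
    assume "z \<in> range up.curve"
    then have *: "z $ i > 0" "side (letter_of i) (ln (z $ i))" for i by (auto simp: up.range_curve)
    then have "letter_shape (letter_of i) (z $ i) > 0" for i using side_ln by blast
    moreover have "z $ i \<noteq> 1" for i using *(2)[of i] by (cases "letter_of i") (auto simp: side_def)
    ultimately show False using False *(1) by simp
  qed
  moreover have "letter_shape (letter_of c) (z $ c) > 0" if "z \<in> domain" "c \<in> starts \<longrightarrow> \<not> start_neg z c"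
      "c \<notin> starts \<longrightarrow> inner_eq z c" for c
    using that letter_shape_nonzero[of "z $ c" "letter_of c"]
    by (auto simp: start_neg_def inner_eq_def not_less less_le)
  ultimately show ?thesis using False by blast
qed

lemma range_down_curve:
  "z \<in> range down.curve \<longleftrightarrow> z \<in> domain \<and> (\<forall>c. c \<notin> starts \<longrightarrow> inner_eq z c) \<and>
     (\<exists>h. \<forall>c\<in>starts. start_neg z c \<and> start_value z c = h)"
proof -
  have neg: "letter_shape (down_letter c) (z $ c) > 0 \<longleftrightarrow> start_neg z c" if "z \<in> domain" "c \<in> starts" for c
    using that letter_shape_other_neg[of "z $ c" "other (letter_of c)"]
    by (cases "letter_of c") (auto simp: down_letter_def start_neg_def)
  show ?thesis
  proof (cases "z \<in> domain \<and> (\<forall>c. letter_shape (down_letter c) (z $ c) > 0)")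
    case True
    then have z: "z \<in> domain" and u: "\<And>c. letter_shape (down_letter c) (z $ c) > 0" by auto
    have pos: "z $ i > 0" and ne: "z $ i \<noteq> 1" for i using z by auto
    have hol: "down.holonomy (\<chi> i. ln (z $ i)) $ c =
       (if c \<in> starts then - ln (start_value z c)
        else ln ((letter_shape (letter_of c) (z $ c))\<^sup>2) + 2 * ln (z $ c) - ln (z $ pv c) - ln (z $ nx c))" for c
    proof -
      have "down.holonomy (\<chi> i. ln (z $ i)) $ c
          = ln ((letter_shape (down_letter c) (z $ c))\<^sup>2) + down.coupling (\<chi> i. ln (z $ i)) $ c"
        unfolding log_shape_ln[OF pos u, symmetric] by (simp add: down.holonomy_def)
      then show ?thesis
        using pos ne by (simp add: down_letter_def ln_letter_shape_other down.coupling_def ln_start_value[OF z])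
    qed
    have "z \<in> range down.curve \<longleftrightarrow>
        (\<exists>\<eta>. down.holonomy (\<chi> i. ln (z $ i)) = \<eta> *\<^sub>R down.start_vector)"
      unfolding down.range_curve using pos u by (simp add: side_ln)
    also have "\<dots> \<longleftrightarrow> (\<exists>\<eta>. (\<forall>c. c \<notin> starts \<longrightarrow> inner_eq z c) \<and>
        (\<forall>c\<in>starts. - ln (start_value z c) = \<eta>))"
    proof -
      have "inner_eq z c \<longleftrightarrow> down.holonomy (\<chi> i. ln (z $ i)) $ c = 0" if "c \<notin> starts" for c
        using inner_eq_ln[OF z, of c] u[of c] that by (simp add: hol down_letter_def)
      then show ?thesis by (auto simp: vec_eq_iff hol down.start_vector_def)
    qed
    also have "\<dots> \<longleftrightarrow> (\<forall>c. c \<notin> starts \<longrightarrow> inner_eq z c) \<and> (\<exists>h. \<forall>c\<in>starts. start_value z c = h)"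
      using start_value_pos[OF z] by (metis exp_ln minus_minus)
    also have "\<dots> \<longleftrightarrow> (\<forall>c. c \<notin> starts \<longrightarrow> inner_eq z c) \<and>
        (\<exists>h. \<forall>c\<in>starts. start_neg z c \<and> start_value z c = h)"
      using u neg[OF z] by simp
    finally show ?thesis using z by blast
  next
    case False
    have "z \<notin> range down.curve"
    proof
      assume "z \<in> range down.curve"
      then have *: "z $ i > 0" "side (down_letter i) (ln (z $ i))" for i by (auto simp: down.range_curve)
      then have "letter_shape (down_letter i) (z $ i) > 0" for i using side_ln by blast
      moreover have "z $ i \<noteq> 1" for i using *(2)[of i] by (cases "down_letter i") (auto simp: side_def)
      ultimately show False using False *(1) by simp
    qed
    moreover have "letter_shape (down_letter c) (z $ c) > 0" if "z \<in> domain" "c \<in> starts \<longrightarrow> start_neg z c"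
        "c \<notin> starts \<longrightarrow> inner_eq z c" for c
      using that neg by (cases "c \<in> starts") (auto simp: down_letter_def inner_eq_def)
    ultimately show ?thesis using False by blast
  qed
qed

lemma V_plus_eq: "V_plus w e = range up.curve \<union> range down.curve"
proof (rule set_eqI)
  fix z
  have "z \<in> V_plus w e \<longleftrightarrow> z \<in> domain \<and> (\<forall>c. c \<notin> starts \<longrightarrow> inner_eq z c) \<and>
      ((\<exists>h. \<forall>c\<in>starts. \<not> start_neg z c \<and> start_value z c = h) \<or>
       (\<exists>h. \<forall>c\<in>starts. start_neg z c \<and> start_value z c = h))"
    unfolding V_plus_iff ex_bool_eq by (simp add: disj_commute)
  then show "z \<in> V_plus w e \<longleftrightarrow> z \<in> range up.curve \<union> range down.curve"
    by (simp only: Un_iff range_up_curve range_down_curve conj_disj_distribL)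
qed

text \<open>
  Position 1 is a start with letter \<open>R\<close>, and there \<open>start_value\<close> is, up to sign, the base of the square
  that defines the puncture length.
\<close>

lemma ln_puncture_length:
  assumes "z \<in> domain"
  shows "ln (puncture_length N e z) = 2 * ln (start_value z (e 1))"
proof -
  have z: "z $ i > 0" "z $ i \<noteq> 1" "z $ i \<noteq> 0" for i using assms by (auto, metis less_irrefl)
  have alg: "n * ((p - 1) / p) * inverse q * inverse (1 / (1 - p)) = - (((p - 1) / p)\<^sup>2 * n * p / q)"
    if "p \<noteq> 0" "q \<noteq> 0" for n p q :: real
    using that by (simp add: field_simps power2_eq_square)
  have "nx (e 1) = e 2" "pv (e 1) = e 0" using pv_e[of 0] by (auto simp: numeral_2_eq_2)
  then have "start_value z (e 1) = ((z $ e 1 - 1) / z $ e 1)\<^sup>2 * z $ e N * z $ e 1 / z $ e 2"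
    using letter_at_1 by (simp add: start_value_def letter_shape_def e_N)
  then have "z $ e N * ((z $ e 1 - 1) / z $ e 1) * inverse (z $ e 2) * inverse (1 / (1 - z $ e 1))
      = - start_value z (e 1)"
    using z[of "e 1"] z[of "e 2"] alg by simp
  then have "puncture_length N e z = (start_value z (e 1))\<^sup>2"
    by (simp add: puncture_length_def shape_x_def shape_y_def shape_z_def)
  then show ?thesis using start_value_pos[OF assms] by (simp add: ln_realpow)
qed

lemma open_domain: "open domain"
proof -
  have "domain = (\<Inter>c. {z. z $ c > 0} \<inter> {z. z $ c \<noteq> 1})" by auto
  also have "open \<dots>"
    by (intro open_INT ballI finite open_Int open_Collect_less open_Collect_neq continuous_intros)
  finally show ?thesis .
qed

lemma smooth_ln_puncture_length: "smooth_on domain (\<lambda>z. ln (puncture_length N e z))"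
proof (rule elementary_coordinates_smooth_on[OF open_domain])
  let ?E = "elementary domain (range (\<lambda>i z. z $ i))"
  let ?g = "\<lambda>z. z $ e N * ((z $ e 1 - 1) * inverse (z $ e 1)) * inverse (z $ e 2) * (1 - z $ e 1)"
  have z: "?E (\<lambda>z. z $ i)" for i by (rule elementary.base) blast
  have inv: "?E (\<lambda>z. inverse (z $ i))" for i by (rule elementary.inverse[OF z]) (metis (mono_tags, lifting) less_irrefl mem_Collect_eq)
  have "?E (\<lambda>z. ln (?g z * ?g z))"
  proof (rule elementary.ln)
    show "?E (\<lambda>z. ?g z * ?g z)"
      by (intro elementary.mult elementary_diff elementary.const z inv)
    fix z assume "z \<in> domain"
    then have "z $ i \<noteq> 0" "z $ i \<noteq> 1" for i by (auto, metis less_irrefl)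
    then have "?g z \<noteq> 0" by simp
    then show "?g z * ?g z > 0" by (metis not_real_square_gt_zero)
  qed
  moreover have "(\<lambda>z. ln (?g z * ?g z)) = (\<lambda>z. ln (puncture_length N e z))"
    by (simp add: puncture_length_def shape_x_def shape_y_def shape_z_def power2_eq_square divide_inverse)
  ultimately show "?E (\<lambda>z. ln (puncture_length N e z))" by simp
qed


lemma puncture_length_up: "ln (puncture_length N e (up.curve \<eta>)) = 2 * \<eta>"
proof -
  let ?z = "up.curve \<eta>"
  have z: "?z \<in> domain" "\<not> start_neg ?z (e 1)"
    using range_up_curve[of ?z] start_1 by blast+
  have "?z $ e 1 > 0" "?z $ e 1 \<noteq> 1" using z(1) by simp_all
  then have "letter_shape (letter_of (e 1)) (?z $ e 1) > 0"
    using letter_shape_nonzero[of "?z $ e 1" "letter_of (e 1)"] z(2) by (auto simp: start_neg_def)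
  then have "up.holonomy (\<chi> i. ln (?z $ i)) $ e 1 = ln (start_value ?z (e 1))"
    using z start_1 by (simp add: up.holonomy_def up.coupling_def log_shape_ln ln_start_value)
  then show ?thesis
    using z start_1 by (simp add: ln_puncture_length up.holonomy_curve up.start_vector_def)
qed

lemma puncture_length_down: "ln (puncture_length N e (down.curve \<eta>)) = - 2 * \<eta>"
proof -
  let ?z = "down.curve \<eta>"
  have z: "?z \<in> domain" "start_neg ?z (e 1)"
    using range_down_curve[of ?z] start_1 by blast+
  then have "letter_shape (other (letter_of (e 1))) (?z $ e 1) > 0"
    using letter_shape_other_neg[of "?z $ e 1" "other (letter_of (e 1))"] letter_at_1
    by (simp add: start_neg_def)
  then have "down.holonomy (\<chi> i. ln (?z $ i)) $ e 1 = - ln (start_value ?z (e 1))"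
    using z start_1
    by (simp add: down.holonomy_def down.coupling_def log_shape_ln ln_start_value
        ln_letter_shape_other down_letter_def)
  then show ?thesis
    using z start_1 by (simp add: ln_puncture_length down.holonomy_curve down.start_vector_def)
qed

end

section \<open>Components\<close>

text \<open>
  Coordinates in \<open>D\<close> avoid 0 and 1, so on a connected subset of \<open>D\<close> their positions relative to these two
  points are constant. A connected subset singled out by such positions is therefore a component.
\<close>

lemma sign_pattern_component:
  fixes D :: "(real^'n) set"
  assumes D: "\<And>z i. z \<in> D \<Longrightarrow> z $ i \<noteq> 0 \<and> z $ i \<noteq> 1"
    and C: "C \<noteq> {}" "connected C" "C \<subseteq> D" "\<And>z i. z \<in> C \<Longrightarrow> z $ i > 0"
    and pattern: "\<And>y z. y \<in> C \<Longrightarrow> z \<in> D \<Longrightarrow> (\<And>i. z $ i > 0 \<and> (z $ i < 1 \<longleftrightarrow> y $ i < 1)) \<Longrightarrow> z \<in> C"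
  shows "C \<in> components D"
  unfolding in_components_maximal
proof (intro conjI allI impI)
  fix E assume "E \<noteq> {} \<and> C \<subseteq> E \<and> E \<subseteq> D \<and> connected E"
  then have E: "C \<subseteq> E" "E \<subseteq> D" "connected E" by auto
  obtain y where y: "y \<in> C" using C by blast
  show "E = C"
  proof
    show "E \<subseteq> C"
    proof
      fix z assume z: "z \<in> E"
      have "z $ i > 0 \<and> (z $ i < 1 \<longleftrightarrow> y $ i < 1)" for i
      proof -
        have conn: "connected ((\<lambda>z. z $ i) ` E)"
          using E(3) by (intro connected_continuous_image continuous_intros)
        have mem: "y $ i \<in> (\<lambda>z. z $ i) ` E" "z $ i \<in> (\<lambda>z. z $ i) ` E" using y z E(1) by auto
        have avoid: "0 \<notin> (\<lambda>z. z $ i) ` E" "1 \<notin> (\<lambda>z. z $ i) ` E" using D E(2) by fastforce+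
        show ?thesis
          using connectedD_interval[OF conn mem, of 0] connectedD_interval[OF conn mem, of 1]
            connectedD_interval[OF conn mem(2,1), of 0] connectedD_interval[OF conn mem(2,1), of 1]
            avoid C(4)[OF y, of i] by (meson less_eq_real_def linorder_not_less)
      qed
      then show "z \<in> C" using pattern[OF y] E(2) z by blast
    qed
  qed (rule E(1))
qed (use C in auto)

context string_cycle
begin

lemma curve_connected: "connected (range curve)"
proof -
  have "smooth_on UNIV curve" using smooth_curve[of 1 0] by simp
  then have "C_k_on 0 UNIV curve" by (simp only: smooth_on_def)
  then show ?thesis by (intro connected_continuous_image) auto
qed

text \<open>
  A function that is linear along the curve in its parameter \<open>\<eta>\<close> has an inverse that is a linear
  reparametrisation of the curve, and the latter is smooth.
\<close>

lemma curve_diffeomorphism: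
  assumes f: "\<And>\<eta>. f (curve \<eta>) = \<kappa> * \<eta>" "\<kappa> \<noteq> 0"
    and U: "open U" "range curve \<subseteq> U" "smooth_on U f"
  shows "diffeomorphism (range curve) (UNIV :: real set) f"
  unfolding diffeomorphism_def
proof (intro conjI)
  have inj: "inj_on f (range curve)" using f by (auto simp: inj_on_def)
  have image: "f ` range curve = UNIV"
  proof -
    have "s = f (curve (s / \<kappa>))" for s using f by simp
    then show ?thesis by blast
  qed
  show "bij_betw f (range curve) UNIV" using inj image by (simp add: bij_betw_def)
  show "smooth_map (range curve) f" unfolding smooth_map_def using U by blast
  have "inv_into (range curve) f s = curve (1 / \<kappa> * s + 0)" for s
    by (rule inv_into_f_eq[OF inj]) (use f in auto)
  then have "smooth_on UNIV (inv_into (range curve) f)"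
    using smooth_curve[of "1 / \<kappa>" 0] by presburger
  then show "smooth_map UNIV (inv_into (range curve) f)" unfolding smooth_map_def by blast
qed

lemma curve_tangent_vector:
  assumes "range curve \<subseteq> D" "p \<in> range curve"
  shows "\<exists>v. tangent_vector D p v \<and> (\<forall>i. v $ i > 0)"
proof -
  obtain a where a: "p = curve a" using assms by blast
  obtain v where v: "((\<lambda>s. curve (s + a)) has_vector_derivative v) (at 0)" "\<And>i. v $ i > 0"
    using curve_positive_tangent by blast
  have "smooth_on UNIV (\<lambda>s. curve (s + a))" using smooth_curve[of 1 a] by simp
  then have "tangent_vector D p v"
    unfolding tangent_vector_def using v(1) assms(1) a
    by (intro exI[of _ "\<lambda>s. curve (s + a)"] exI[of _ 1])
      (auto intro: smooth_on_subset[of _ UNIV])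
  with v(2) show ?thesis by blast
qed

end

lemma smooth_one_manifold_of_chart:
  "diffeomorphism S (UNIV :: real set) f \<Longrightarrow> smooth_one_manifold S"
  unfolding smooth_one_manifold_def by (metis Int_UNIV_right UNIV_I open_UNIV)

context monodromy_cycle
begin

lemma deformation_variety_avoids: "z \<in> deformation_variety w e \<Longrightarrow> z $ i \<noteq> 0 \<and> z $ i \<noteq> 1"
  by (simp add: deformation_variety_def)

lemma range_curves_subset:
  "range up.curve \<subseteq> deformation_variety w e" "range down.curve \<subseteq> deformation_variety w e"
  using V_plus_eq by (auto simp: V_plus_def)

text \<open>
  Both sets consist of positive points, and they are told apart by the sign at the first start.
\<close>

lemma curves_components:
  "range up.curve \<in> components (deformation_variety w e)"
  "range down.curve \<in> components (deformation_variety w e)"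
proof -
  have same: "start_neg z c \<longleftrightarrow> start_neg y c"
    if "y \<in> domain" "z \<in> deformation_variety w e" "\<And>i. z $ i > 0 \<and> (z $ i < 1 \<longleftrightarrow> y $ i < 1)" for y z c
    unfolding start_neg_def
    using that deformation_variety_avoids[of z] by (intro letter_shape_sign_cong) auto
  have V: "z \<in> range up.curve \<and> \<not> start_neg z (e 1) \<or> z \<in> range down.curve \<and> start_neg z (e 1)"
    if "z \<in> deformation_variety w e" "\<And>i. z $ i > 0" for z
  proof -
    have "z \<in> range up.curve \<union> range down.curve"
      using that unfolding V_plus_eq[symmetric] V_plus_def by blast
    then show ?thesis using range_up_curve[of z] range_down_curve[of z] start_1 by blast
  qed
  show "range up.curve \<in> components (deformation_variety w e)"
  proof (rule sign_pattern_component[OF deformation_variety_avoids _ up.curve_connected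
        range_curves_subset(1)])
    fix y z assume y: "y \<in> range up.curve" and z: "z \<in> deformation_variety w e"
      "\<And>i. z $ i > 0 \<and> (z $ i < 1 \<longleftrightarrow> y $ i < 1)"
    have "y \<in> domain" "\<not> start_neg y (e 1)" using range_up_curve[of y] y start_1 by blast+
    then show "z \<in> range up.curve" using same[OF _ z] V[OF z(1)] z(2) by blast
  qed (auto simp: up.curve_pos)
  show "range down.curve \<in> components (deformation_variety w e)"
  proof (rule sign_pattern_component[OF deformation_variety_avoids _ down.curve_connected
        range_curves_subset(2)])
    fix y z assume y: "y \<in> range down.curve" and z: "z \<in> deformation_variety w e"
      "\<And>i. z $ i > 0 \<and> (z $ i < 1 \<longleftrightarrow> y $ i < 1)"
    have "y \<in> domain" "start_neg y (e 1)" using range_down_curve[of y] y start_1 by blast+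
    then show "z \<in> range down.curve" using same[OF _ z] V[OF z(1)] z(2) by blast
  qed (auto simp: down.curve_pos)
qed

lemma curves_distinct: "range up.curve \<noteq> range down.curve"
proof -
  have "\<not> start_neg (up.curve 0) (e 1)" using range_up_curve[of "up.curve 0"] start_1 by blast
  moreover have "start_neg z (e 1)" if "z \<in> range down.curve" for z
    using range_down_curve[of z] start_1 that by blast
  ultimately show ?thesis by blast
qed

lemma puncture_length_diffeomorphisms:
  "diffeomorphism (range up.curve) (UNIV :: real set) (\<lambda>z. ln (puncture_length N e z))"
  "diffeomorphism (range down.curve) (UNIV :: real set) (\<lambda>z. ln (puncture_length N e z))"
proof -
  have "range up.curve \<subseteq> domain" "range down.curve \<subseteq> domain"
    using range_up_curve range_down_curve by blast+
  then show "diffeomorphism (range up.curve) (UNIV :: real set) (\<lambda>z. ln (puncture_length N e z))"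
    "diffeomorphism (range down.curve) (UNIV :: real set) (\<lambda>z. ln (puncture_length N e z))"
    using up.curve_diffeomorphism[OF puncture_length_up _ open_domain _ smooth_ln_puncture_length]
      down.curve_diffeomorphism[OF puncture_length_down _ open_domain _ smooth_ln_puncture_length]
    by auto
qed

end

theorem theorem1:
  fixes \<phi> :: "int^2^2"
    and w :: "letter list"
    and e :: "nat \<Rightarrow> 'n::finite"
  assumes "anosov \<phi>"
    and "monodromy_word \<phi> w"
    and "cyclic_labelling (length w) e"
  shows "\<exists>C1 C2.
      C1 \<in> components (deformation_variety w e) \<and>
      C2 \<in> components (deformation_variety w e) \<and>
      C1 \<noteq> C2 \<and>
      V_plus w e = C1 \<union> C2 \<and>
      (\<forall>C\<in>{C1, C2}.
         smooth_one_manifold C \<and>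
         (\<forall>p\<in>C. \<exists>v. tangent_vector (deformation_variety w e) p v \<and> (\<forall>i. v $ i > 0)) \<and>
         (\<exists>J. open J \<and> diffeomorphism C J (\<lambda>z. ln (puncture_length (length w) e z))))"
proof -
  obtain bs where bs: "bs \<noteq> []" "\<forall>(m, n) \<in> set bs. m \<ge> 1 \<and> n \<ge> 1" "w = block_word bs"
    using assms(2) unfolding monodromy_word_def by blast
  interpret monodromy_cycle w e
    using block_word_ends[OF bs(1,2)] assms(3) bs(3) by unfold_locales simp_all
  have chart: "smooth_one_manifold C \<and>
      (\<exists>J. open J \<and> diffeomorphism C J (\<lambda>z. ln (puncture_length N e z)))"
    if "C \<in> {range up.curve, range down.curve}" for C
  proof -
    have "diffeomorphism C (UNIV :: real set) (\<lambda>z. ln (puncture_length N e z))"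
      using that puncture_length_diffeomorphisms by blast
    then show ?thesis using smooth_one_manifold_of_chart open_UNIV by blast
  qed
  have tangent: "\<exists>v. tangent_vector (deformation_variety w e) p v \<and> (\<forall>i. v $ i > 0)"
    if "C \<in> {range up.curve, range down.curve}" "p \<in> C" for C p
    using that up.curve_tangent_vector[OF range_curves_subset(1)]
      down.curve_tangent_vector[OF range_curves_subset(2)] by auto
  show ?thesis
  proof (rule exI[of _ "range up.curve"], rule exI[of _ "range down.curve"], intro conjI ballI)
    fix C assume C: "C \<in> {range up.curve, range down.curve}"
    show "smooth_one_manifold C" using chart[OF C] by blast
    show "\<exists>J. open J \<and> diffeomorphism C J (\<lambda>z. ln (puncture_length N e z))"
      using chart[OF C] by blast
    fix p assume "p \<in> C"
    then show "\<exists>v. tangent_vector (deformation_variety w e) p v \<and> (\<forall>i. v $ i > 0)"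
      by (rule tangent[OF C])
  qed (rule curves_components curves_distinct V_plus_eq)+
qed

end
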